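(* For every $\rho\ge1$ and every dimension $d$ there exists a function $\beta\colon(0,1]\to(0,1)$ with the following property. Let $0\le k\le d$ be an integer, $\alpha\in(0,1]$, and let $\mathcal{F}_1,\ldots,\mathcal{F}_{k+2}$ be finite nonempty families of $\rho$-fat (spherically) convex sets in $\mathbb{S}^d$. If at least $\alpha|\mathcal{F}_1|\cdots|\mathcal{F}_{k+2}|$ of the colorful selections have a spherical $k$-transversal, then there exists an index $i$ such that $\mathcal{F}_i$ has a subfamily of size at least $\beta(\alpha)|\mathcal{F}_i|$ which has a spherical $k$-transversal.
   Context: $\mathbb{S}^d$ is the unit sphere in $\mathbb{R}^{d+1}$ centered at the origin. For $x\in\mathbb{S}^d$ and $\varepsilon\ge0$, the cap $B(x,\varepsilon)=\{y\in\mathbb{S}^d:\angle(x,y)\le\varepsilon\}$. A great $k$-sphere is the intersection of $\mathbb{S}^d$ with a $(k+1)$-dimensional linear subspace of $\mathbb{R}^{d+1}$; a family has a spherical $k$-transversal if some great $k$-sphere intersects all its members. A set $K\subseteq\mathbb{S}^d$ is (spherically) convex if either $K=\mathbb{S}^d$, or $K$ contains no pair of antipodal points $v,-v$ and contains the shorter great circle arc between any two of its points. A family $\mathcal{F}$ of subsets of $\mathbb{S}^d$ is $\rho$-fat if for each $K\in\mathcal{F}$ there are $x_K\in\mathbb{S}^d$ and $0<r_K\le R_K\le\rho r_K$ with $B(x_K,r_K)\subseteq K\subseteq B(x_K,R_K)$. A colorful selection is a tuple $(K_1,\ldots,K_{k+2})$ with $K_j\in\mathcal{F}_j$. *)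

theory Defs
  imports "HOL-Analysis.Analysis"
begin

abbreviation unit_sphere :: "'a::euclidean_space set" where
  "unit_sphere \<equiv> sphere 0 1"

text \<open>For vectors of norm 1, as they occur below, \<open>arccos\<close> is applied to a number in \<open>[-1, 1]\<close>.\<close>

definition sph_angle :: "'a::euclidean_space \<Rightarrow> 'a \<Rightarrow> real" where
  "sph_angle x y = arccos (x \<bullet> y)"

definition cap :: "'a::euclidean_space \<Rightarrow> real \<Rightarrow> 'a set" where
  "cap x \<epsilon> = {y \<in> unit_sphere. sph_angle x y \<le> \<epsilon>}"

definition great_sphere :: "nat \<Rightarrow> 'a::euclidean_space set \<Rightarrow> bool" where
  "great_sphere k S \<longleftrightarrow> (\<exists>V. subspace V \<and> dim V = k + 1 \<and> S = unit_sphere \<inter> V)"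

definition has_sph_transversal :: "nat \<Rightarrow> 'a::euclidean_space set set \<Rightarrow> bool" where
  "has_sph_transversal k \<F> \<longleftrightarrow> (\<exists>S. great_sphere k S \<and> (\<forall>K\<in>\<F>. S \<inter> K \<noteq> {}))"

text \<open>The shorter great circle arc between two non-antipodal points of the unit sphere is the
  radial projection of their chord, since \<open>sgn v = v /\<^sub>R norm v\<close>; it is a single point if the two
  points coincide. For antipodal points this set is meaningless and is not used.\<close>

definition short_arc :: "'a::euclidean_space \<Rightarrow> 'a \<Rightarrow> 'a set" where
  "short_arc x y = sgn ` closed_segment x y"

definition sph_convex :: "'a::euclidean_space set \<Rightarrow> bool" where
  "sph_convex K \<longleftrightarrow> K \<subseteq> unit_sphere \<and>
     (K = unit_sphere \<or>
      (\<forall>v\<in>K. - v \<notin> K) \<and> (\<forall>x\<in>K. \<forall>y\<in>K. short_arc x y \<subseteq> K))"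

definition fat_family :: "real \<Rightarrow> 'a::euclidean_space set set \<Rightarrow> bool" where
  "fat_family \<rho> \<F> \<longleftrightarrow>
     (\<forall>K\<in>\<F>. \<exists>x\<in>unit_sphere. \<exists>r R. 0 < r \<and> r \<le> R \<and> R \<le> \<rho> * r \<and>
        cap x r \<subseteq> K \<and> K \<subseteq> cap x R)"

text \<open>A colorful selection is encoded as an extensional function on the index set \<open>{1..m}\<close>,
  so that distinct tuples are distinct functions and the selections can be counted by \<open>card\<close>.\<close>

definition colorful_selections :: "nat \<Rightarrow> (nat \<Rightarrow> 'a set set) \<Rightarrow> (nat \<Rightarrow> 'a set) set" where
  "colorful_selections m F = (\<Pi>\<^sub>E j\<in>{1..m}. F j)"

end

theory Submission
  imports Defs
begin

text \<open>
  Replace every set by the union of the lines through it; a spherical \<open>k\<close>-transversal becomes a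
  subspace of dimension at most \<open>k + 1\<close> meeting these double cones. Convexity is used only through
  its consequence that a fat set of size \<open>s\<close> contains, near each of its points and at each scale
  \<open>\<epsilon> \<le> s\<close>, a ball of radius comparable to \<open>\<epsilon>\<close>. This property survives thickening and projection.
  Induct on \<open>k\<close>. By averaging, fix the smallest member of many good selections, of size \<open>\<delta>\<close>, and a
  point \<open>x\<close> of it. After a perturbation of order \<open>\<delta>\<close> the transversals pass through \<open>x\<close>, so the
  \<open>2\<delta>\<close>-thickenings of the other sets, projected along \<open>x\<close>, satisfy the hypothesis for \<open>k - 1\<close>. (Sets
  within \<open>8\<delta>\<close> of \<open>\<plusminus>x\<close> have no fat projection; if there are many of these, the line through \<open>x\<close>
  takes the place of the inductive step.) This gives a subspace within \<open>O(\<delta>)\<close> of a positive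
  fraction of one family, whose members have size at least \<open>\<delta>\<close>. By compactness, finitely many
  perturbations of size \<open>O(\<delta>)\<close> suffice to hit them, and the best one hits a positive fraction.
\<close>

section \<open>Fat double cones and their projections\<close>

definition perp :: "'a::euclidean_space \<Rightarrow> 'a \<Rightarrow> 'a" where
  "perp x v = v - (v \<bullet> x) *\<^sub>R x"

lemma linear_perp: "linear (perp x)"
  by (rule linearI) (simp_all add: perp_def algebra_simps inner_simps)

lemma norm_perp_square:
  assumes "norm x = 1"
  shows "(norm (perp x v))\<^sup>2 = (norm v)\<^sup>2 - (v \<bullet> x)\<^sup>2"
proof -
  have "x \<bullet> x = 1" using assms by (simp add: norm_eq_1)
  then have "perp x v \<bullet> perp x v = v \<bullet> v - (v \<bullet> x) * (v \<bullet> x)"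
    by (simp add: perp_def inner_simps algebra_simps inner_commute)
  then show ?thesis by (simp only: power2_norm_eq_inner power2_eq_square[of "v \<bullet> x"])
qed

lemma norm_perp_le:
  assumes "norm x = 1"
  shows "norm (perp x v) \<le> norm v"
  by (rule power2_le_imp_le) (simp_all add: norm_perp_square[OF assms])

lemma perp_in_subspace: "subspace W \<Longrightarrow> x \<in> W \<Longrightarrow> v \<in> W \<Longrightarrow> perp x v \<in> W"
  by (simp add: perp_def subspace_diff subspace_scale)

lemma perp_orthogonal: "norm x = 1 \<Longrightarrow> perp x v \<bullet> x = 0"
  by (simp add: perp_def inner_simps norm_eq_1)

lemma perp_add_orthogonal:
  "norm x = 1 \<Longrightarrow> w \<bullet> x = 0 \<Longrightarrow> perp x (w + t *\<^sub>R x) = w"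
  by (simp add: perp_def inner_simps norm_eq_1)

text \<open>The image stays inside \<open>U\<close> but loses \<open>x\<close>, since everything in
  it is orthogonal to \<open>x\<close>. This drop in dimension drives the induction.\<close>

lemma dim_perp_image_less:
  assumes "subspace U" "x \<in> U" "norm x = 1"
  shows "dim (perp x ` U) < dim U"
proof (rule dim_psubset)
  have s: "subspace (perp x ` U)"
    using assms(1) linear_perp linear_subspace_image by blast
  have "perp x ` U \<subseteq> U" using assms perp_in_subspace by blast
  moreover have "x \<notin> perp x ` U"
    using assms(3) perp_orthogonal[OF assms(3)] by (metis imageE norm_eq_1 zero_neq_one)
  ultimately have "perp x ` U \<subset> U" using assms(2) by blast
  then show "span (perp x ` U) \<subset> span U"
    using s assms(1) by (simp add: span_eq_iff[THEN iffD2])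
qed

text \<open>With \<open>h = u \<bullet> x\<close>, the nearer pole is at squared distance
  \<open>2 - 2 * abs h\<close>, while the projection has squared norm \<open>1 - h ^ 2\<close>; the
  inequality \<open>h ^ 2 \<le> abs h\<close> compares the two.\<close>

lemma near_pole:
  assumes x: "norm x = 1" and u: "norm u = 1"
  shows "\<exists>p\<in>{x, - x}. norm (p - u) \<le> 2 * norm (perp x u)"
proof -
  define h where "h = u \<bullet> x"
  have xx: "x \<bullet> x = 1" "u \<bullet> u = 1" using assms by (simp_all add: norm_eq_1)
  have h1: "\<bar>h\<bar> \<le> 1" using Cauchy_Schwarz_ineq2[of u x] assms by (simp add: h_def)
  have P: "(norm (perp x u))\<^sup>2 = 1 - h\<^sup>2"
    using norm_perp_square[OF x] u by (simp add: h_def)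
  have m: "(norm (x - u))\<^sup>2 = 2 - 2 * h" and p: "(norm (- x - u))\<^sup>2 = 2 + 2 * h"
    using xx by (simp_all add: power2_norm_eq_inner inner_simps h_def algebra_simps inner_commute)
  have key: "2 - 2 * \<bar>h\<bar> \<le> (2 * norm (perp x u))\<^sup>2"
  proof -
    have "\<bar>h\<bar> * \<bar>h\<bar> \<le> \<bar>h\<bar> * 1" using h1 by (intro mult_left_mono) auto
    then have "h\<^sup>2 \<le> \<bar>h\<bar>" by (simp add: power2_eq_square)
    then show ?thesis using P h1 by (simp add: power_mult_distrib)
  qed
  show ?thesis
  proof (cases "h \<ge> 0")
    case True
    then have "(norm (x - u))\<^sup>2 \<le> (2 * norm (perp x u))\<^sup>2" using key m by simp
    then have "norm (x - u) \<le> 2 * norm (perp x u)" by (rule power2_le_imp_le) simp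
    then show ?thesis by blast
  next
    case False
    then have "(norm (- x - u))\<^sup>2 \<le> (2 * norm (perp x u))\<^sup>2" using key p by simp
    then have "norm (- x - u) \<le> 2 * norm (perp x u)" by (rule power2_le_imp_le) simp
    then show ?thesis by blast
  qed
qed

section \<open>Fat double cones, their thickenings and projections\<close>

text \<open>\<open>K\<close> is a double cone in the subspace \<open>W\<close> and \<open>s\<close> is its angular size. Both the bound on the
  diameter and the interior balls are relative to the norms of the points, so no normalization to
  the sphere is needed; since \<open>t = 0\<close> is allowed, the diameter condition is void for \<open>s = 1\<close>.\<close>

definition fat_cone :: "real \<Rightarrow> 'a::euclidean_space set \<Rightarrow> real \<Rightarrow> 'a set \<Rightarrow> bool" where
  "fat_cone c W s K \<longleftrightarrow>
     K \<subseteq> W \<and> 0 \<notin> K \<and> K \<noteq> {} \<and> 0 < s \<and> s \<le> 1 \<and>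
     (\<forall>p\<in>K. \<forall>t. t \<noteq> 0 \<longrightarrow> t *\<^sub>R p \<in> K) \<and>
     (\<forall>p\<in>K. \<forall>q\<in>K. \<exists>t. norm (t *\<^sub>R p - q) \<le> s * norm q) \<and>
     (\<forall>p\<in>K. \<forall>\<epsilon>. 0 < \<epsilon> \<and> \<epsilon> \<le> s \<longrightarrow>
        (\<exists>y\<in>W. norm (y - p) \<le> \<epsilon> * norm p \<and> (\<forall>z\<in>W. norm (z - y) \<le> c * \<epsilon> * norm p \<longrightarrow> z \<in> K)))"

lemma fat_coneD:
  assumes "fat_cone c W s K"
  shows "K \<subseteq> W" "0 \<notin> K" "K \<noteq> {}" "0 < s" "s \<le> 1"
    and "\<And>p t. p \<in> K \<Longrightarrow> t \<noteq> 0 \<Longrightarrow> t *\<^sub>R p \<in> K"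
    and "\<And>p q. p \<in> K \<Longrightarrow> q \<in> K \<Longrightarrow> \<exists>t. norm (t *\<^sub>R p - q) \<le> s * norm q"
    and "\<And>p \<epsilon>. p \<in> K \<Longrightarrow> 0 < \<epsilon> \<Longrightarrow> \<epsilon> \<le> s \<Longrightarrow>
        \<exists>y\<in>W. norm (y - p) \<le> \<epsilon> * norm p \<and> (\<forall>z\<in>W. norm (z - y) \<le> c * \<epsilon> * norm p \<longrightarrow> z \<in> K)"
  using assms unfolding fat_cone_def by blast+

lemma fat_cone_unit:
  assumes "fat_cone c W s K"
  obtains u where "u \<in> K" "norm u = 1"
proof -
  obtain v where v: "v \<in> K" "v \<noteq> 0" using fat_coneD(2,3)[OF assms] by blast
  have "inverse (norm v) *\<^sub>R v \<in> K" using fat_coneD(6)[OF assms v(1)] v(2) by simp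
  then show thesis using that[of "inverse (norm v) *\<^sub>R v"] v(2) by simp
qed

text \<open>The radius \<open>2 * \<delta>\<close> is the displacement caused by the perturbation in
  \<open>transversal_project\<close>. It is relative to norms, so thickening respects
  scaling.\<close>

definition cone_nbhd :: "'a::euclidean_space set \<Rightarrow> real \<Rightarrow> 'a set \<Rightarrow> 'a set" where
  "cone_nbhd W \<delta> K = {z \<in> W. \<exists>u\<in>K. norm (z - u) \<le> 2 * \<delta> * norm u}"

text \<open>Assumption \<open>far\<close> keeps the thickened cone off the line through
  \<open>x\<close>, so its projection avoids \<open>0\<close>. Balls inside \<open>K\<close> project
  to balls, but a thickened point may be \<open>2 * \<delta> * norm u\<close> away from
  \<open>K\<close>; below that scale the thickening itself must supply the ball.\<close>

lemma fat_cone_project: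
  assumes K: "fat_cone c W s K" and c: "0 < c" "c \<le> 1" and W: "subspace W"
    and x: "x \<in> W" "norm x = 1" and \<delta>: "0 < \<delta>" "\<delta> \<le> s"
    and far: "\<And>u. u \<in> K \<Longrightarrow> 8 * \<delta> * norm u < norm (perp x u)"
  shows "\<exists>s'. fat_cone (c / 60) {w \<in> W. w \<bullet> x = 0} s' (perp x ` cone_nbhd W \<delta> K)"
proof -
  let ?W' = "{w \<in> W. w \<bullet> x = 0}" and ?N = "{z \<in> W. \<exists>u\<in>K. norm (z - u) \<le> 2 * \<delta> * norm u}"
  note KD = fat_coneD[OF K]
  interpret P: linear "perp x" by (rule linear_perp)
  obtain u0 where u0: "u0 \<in> K" "norm u0 = 1" using fat_cone_unit[OF K] .
  define \<theta> where "\<theta> = norm (perp x u0)"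
  have \<theta>: "8 * \<delta> < \<theta>" "0 < \<theta>" "\<theta> \<le> 1"
    using far[OF u0(1)] u0 \<delta> norm_perp_le[OF x(2), of u0] by (auto simp: \<theta>_def)
  \<comment> \<open>Seen from \<open>x\<close>, the cone lies at distance about \<open>\<theta>\<close>, which magnifies its size by \<open>1 / \<theta>\<close>.\<close>
  define s' where "s' = min 1 (20 * s / \<theta>)"
  have s': "0 < s'" "s' \<le> 1" "s' * \<theta> \<le> 20 * s"
    using \<theta> KD(4) by (auto simp: s'_def min_def field_simps)
  \<comment> \<open>By \<open>far\<close>, the displacement \<open>2 * \<delta> * norm u\<close> is
    less than a quarter of \<open>norm (perp x u)\<close>.\<close>
  have width: "3 / 4 * norm (perp x u) \<le> norm (perp x z) \<and> norm (perp x z) \<le> 5 / 4 * norm (perp x u)"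
    if "u \<in> K" "norm (z - u) \<le> 2 * \<delta> * norm u" for u z
  proof -
    have "norm (perp x z - perp x u) \<le> 2 * \<delta> * norm u"
      using norm_perp_le[OF x(2), of "z - u"] that(2) by (simp add: P.diff)
    then show ?thesis using far[OF that(1)] norm_triangle_ineq2[of "perp x z" "perp x u"]
      norm_triangle_ineq2[of "perp x u" "perp x z"] norm_minus_commute[of "perp x z" "perp x u"] by linarith
  qed
  have scale: "\<bar>t\<bar> * norm p \<le> (1 + s) * norm q" if "norm (t *\<^sub>R p - q) \<le> s * norm q" for t :: real and p q :: 'a
    using that norm_triangle_ineq2[of "t *\<^sub>R p" q] by (simp add: algebra_simps)
  have lin: "norm (perp x q) \<le> \<bar>t\<bar> * norm (perp x p) + s * norm q"
    if "norm (t *\<^sub>R p - q) \<le> s * norm q" for t :: real and p q :: 'a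
  proof -
    have "norm (t *\<^sub>R perp x p - perp x q) \<le> s * norm q"
      using norm_perp_le[OF x(2), of "t *\<^sub>R p - q"] that by (simp add: P.diff P.scale)
    then show ?thesis using norm_triangle_ineq2[of "perp x q" "t *\<^sub>R perp x p"]
      by (simp add: norm_minus_commute)
  qed
  have upper: "norm (perp x u) \<le> (2 * \<theta> + s) * norm u" if uK: "u \<in> K" for u
  proof -
    obtain t where t: "norm (t *\<^sub>R u0 - u) \<le> s * norm u" using KD(7)[OF u0(1) uK] by blast
    have "\<bar>t\<bar> \<le> (1 + s) * norm u" using scale[OF t] u0 by simp
    also have "\<dots> \<le> 2 * norm u" using KD(5) by (intro mult_right_mono) auto
    finally have "\<bar>t\<bar> * \<theta> \<le> 2 * norm u * \<theta>" using \<theta> by (intro mult_right_mono) auto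
    then show ?thesis using lin[OF t] by (simp add: \<theta>_def[symmetric] algebra_simps)
  qed
  \<comment> \<open>When \<open>s\<close> is small against \<open>\<theta>\<close>, all of the cone
    is about as far from the line through \<open>x\<close> as \<open>u0\<close> is; the comparison
    gives the ratio \<open>19 / 21\<close>, which exceeds \<open>9 / 10\<close>.\<close>
  have lower: "9 / 10 * \<theta> * norm u \<le> norm (perp x u)" if uK: "u \<in> K" "20 * s < \<theta>" for u
  proof -
    obtain t where t: "norm (t *\<^sub>R u - u0) \<le> s * norm u0" using KD(7)[OF uK(1) u0(1)] by blast
    have "\<bar>t\<bar> * norm u \<le> 21 / 20" using scale[OF t] u0 uK(2) \<theta> by simp
    then have "(\<bar>t\<bar> * norm u) * norm (perp x u) \<le> 21 / 20 * norm (perp x u)"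
      by (intro mult_right_mono) auto
    moreover have "19 / 20 * \<theta> \<le> \<bar>t\<bar> * norm (perp x u)"
      using lin[OF t] u0 uK(2) by (simp add: \<theta>_def[symmetric])
    then have "19 / 20 * \<theta> * norm u \<le> \<bar>t\<bar> * norm (perp x u) * norm u"
      by (intro mult_right_mono) auto
    moreover have "0 \<le> \<theta> * norm u" using \<theta> by simp
    ultimately show ?thesis by (simp add: mult_ac)
  qed
  have lift: "z' \<in> perp x ` ?N"
    if "z' \<in> W" "z' \<bullet> x = 0" "u \<in> K" "norm (z' + t *\<^sub>R x - u) \<le> 2 * \<delta> * norm u" for z' t u
  proof
    show "z' = perp x (z' + t *\<^sub>R x)" using perp_add_orthogonal[OF x(2) that(2)] by simp
    show "z' + t *\<^sub>R x \<in> ?N" using that W x by (auto intro: subspace_add subspace_scale)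
  qed
  have "fat_cone (c / 60) ?W' s' (perp x ` ?N)"
    unfolding fat_cone_def
  proof (intro conjI ballI allI impI)
    show "perp x ` ?N \<subseteq> ?W'"
      using perp_in_subspace[OF W x(1)] perp_orthogonal[OF x(2)] by auto
    show "0 \<notin> perp x ` ?N"
    proof
      assume "0 \<in> perp x ` ?N"
      then obtain z u where z: "perp x z = 0" "u \<in> K" "norm (z - u) \<le> 2 * \<delta> * norm u" by auto
      then have "norm (perp x u) \<le> 0" using width[OF z(2,3)] by simp
      moreover have "0 \<le> 8 * \<delta> * norm u" using \<delta> by simp
      ultimately show False using far[OF z(2)] by linarith
    qed
    have "u0 \<in> ?N" using u0 KD(1) \<delta> by (auto intro!: bexI[of _ u0])
    then show "perp x ` ?N \<noteq> {}" by blast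
    show "0 < s'" "s' \<le> 1" using s' by auto
  next
    fix p and t :: real assume p: "p \<in> perp x ` ?N" and t: "t \<noteq> 0"
    obtain z u where z: "p = perp x z" "z \<in> W" "u \<in> K" "norm (z - u) \<le> 2 * \<delta> * norm u"
      using p by auto
    have "norm (t *\<^sub>R z - t *\<^sub>R u) \<le> 2 * \<delta> * norm (t *\<^sub>R u)"
      using mult_left_mono[OF z(4), of "\<bar>t\<bar>"] by (simp flip: scaleR_diff_right add: mult_ac)
    then have "t *\<^sub>R z \<in> ?N" using KD(6)[OF z(3) t] subspace_scale[OF W z(2)] by blast
    then show "t *\<^sub>R p \<in> perp x ` ?N" unfolding z(1) P.scale[symmetric] by (rule imageI)
  next
    fix p q assume p: "p \<in> perp x ` ?N" and q: "q \<in> perp x ` ?N"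
    show "\<exists>t. norm (t *\<^sub>R p - q) \<le> s' * norm q"
    proof (cases "\<theta> \<le> 20 * s")
      case True
      then have "s' = 1" using \<theta> by (simp add: s'_def)
      then show ?thesis by (intro exI[of _ 0]) simp
    next
      case False
      then have s'_eq: "s' = 20 * s / \<theta>" using \<theta> by (simp add: s'_def)
      obtain z u where z: "p = perp x z" "z \<in> W" "u \<in> K" "norm (z - u) \<le> 2 * \<delta> * norm u"
        using p by auto
      obtain y v where y: "q = perp x y" "y \<in> W" "v \<in> K" "norm (y - v) \<le> 2 * \<delta> * norm v"
        using q by auto
      obtain t where t: "norm (t *\<^sub>R u - v) \<le> s * norm v" using KD(7)[OF z(3) y(3)] by blast
      have "\<bar>t\<bar> * norm u \<le> (1 + s) * norm v" by (rule scale[OF t])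
      also have "\<dots> \<le> 2 * norm v" using KD(5) by (intro mult_right_mono) auto
      finally have "2 * \<delta> * (\<bar>t\<bar> * norm u) \<le> 2 * \<delta> * (2 * norm v)"
        using \<delta> by (intro mult_left_mono) auto
      moreover have "\<bar>t\<bar> * norm (z - u) \<le> \<bar>t\<bar> * (2 * \<delta> * norm u)"
        using z(4) by (intro mult_left_mono) auto
      ultimately have A: "norm (t *\<^sub>R z - t *\<^sub>R u) \<le> 4 * \<delta> * norm v"
        by (simp flip: scaleR_diff_right add: mult_ac)
      have "norm (t *\<^sub>R p - q) \<le> norm (t *\<^sub>R z - y)"
        using norm_perp_le[OF x(2), of "t *\<^sub>R z - y"] z(1) y(1) by (simp add: P.diff P.scale)
      also have "t *\<^sub>R z - y = (t *\<^sub>R z - t *\<^sub>R u) + (t *\<^sub>R u - v) + (v - y)" by simp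
      also have "norm \<dots> \<le> norm (t *\<^sub>R z - t *\<^sub>R u) + norm (t *\<^sub>R u - v) + norm (v - y)"
        by (intro order_trans[OF norm_triangle_ineq] add_right_mono norm_triangle_ineq)
      also have "\<dots> \<le> 4 * \<delta> * norm v + s * norm v + 2 * \<delta> * norm v"
        using A t y(4) by (intro add_mono) (simp_all add: norm_minus_commute)
      also have "\<dots> = (6 * \<delta> + s) * norm v" by (simp add: algebra_simps)
      also have "\<dots> \<le> 7 * s * norm v" using \<delta> by (intro mult_right_mono) auto
      also have "\<dots> \<le> s' * norm q"
      proof -
        \<comment> \<open>The factor is \<open>3 / 4\<close> from \<open>width\<close> times
          \<open>9 / 10\<close> from \<open>lower\<close>. Multiplied by the \<open>20\<close> in
          \<open>s'\<close> it becomes \<open>27 / 2\<close>, which covers the \<open>7\<close>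
          collected above.\<close>
        have "27 / 40 * \<theta> * norm v \<le> norm q"
          using width[OF y(3,4)] lower[OF y(3)] False y(1) by simp
        then have "s' * (27 / 40 * \<theta> * norm v) \<le> s' * norm q"
          using s' by (intro mult_left_mono) auto
        moreover have "s' * (27 / 40 * \<theta> * norm v) = 27 / 2 * (s * norm v)"
          using \<theta> by (simp add: s'_eq)
        moreover have "0 \<le> s * norm v" using KD(4) by simp
        ultimately show ?thesis by linarith
      qed
      finally show ?thesis by blast
    qed
  next
    fix p \<epsilon> assume p: "p \<in> perp x ` ?N" and "0 < \<epsilon> \<and> \<epsilon> \<le> s'"
    then have \<epsilon>: "0 < \<epsilon>" "\<epsilon> \<le> s'" by auto
    obtain z u where z: "p = perp x z" "z \<in> W" "u \<in> K" "norm (z - u) \<le> 2 * \<delta> * norm u"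
      using p by auto
    have u_pos: "0 < norm u" using KD(2) z(3) by auto
    have p_pos: "0 < norm p"
    proof -
      have "0 < 8 * \<delta> * norm u" using \<delta> u_pos by simp
      then show ?thesis unfolding z(1) using far[OF z(3)] width[OF z(3,4)] by linarith
    qed
    define e where "e = \<epsilon> * norm p"
    have e_pos: "0 < e" using \<epsilon> p_pos by (simp add: e_def)
    \<comment> \<open>Source of the \<open>60\<close> in \<open>c / 60\<close>: the bound makes
      \<open>e / (60 * norm u)\<close> an admissible scale for \<open>K\<close>.\<close>
    have e_le: "e \<le> 60 * s * norm u"
    proof -
      have "norm p \<le> 5 / 4 * ((2 * \<theta> + s) * norm u)"
        using width[OF z(3,4)] upper[OF z(3)] z(1) by simp
      then have "e \<le> \<epsilon> * (5 / 4 * ((2 * \<theta> + s) * norm u))"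
        unfolding e_def using \<epsilon> by (intro mult_left_mono) auto
      also have "\<dots> = 5 / 4 * ((2 * (\<epsilon> * \<theta>) + \<epsilon> * s) * norm u)" by (simp add: algebra_simps)
      also have "\<dots> \<le> 5 / 4 * ((2 * (20 * s) + 1 * s) * norm u)"
      proof -
        have "\<epsilon> * \<theta> \<le> 20 * s" using \<epsilon> \<theta> s'(3) mult_right_mono[of \<epsilon> s' \<theta>] by linarith
        moreover have "\<epsilon> * s \<le> 1 * s" using \<epsilon> s'(2) KD(4) by (intro mult_right_mono) auto
        ultimately have "2 * (\<epsilon> * \<theta>) + \<epsilon> * s \<le> 2 * (20 * s) + 1 * s" by linarith
        then show ?thesis by (intro mult_left_mono mult_right_mono) auto
      qed
      also have "\<dots> = 205 / 4 * (s * norm u)" by simp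
      also have "\<dots> \<le> 60 * (s * norm u)" using KD(4) by (intro mult_right_mono) auto
      finally show ?thesis by simp
    qed
    have "\<exists>y\<in>W. norm (y - z) \<le> e \<and>
        (\<forall>q\<in>W. norm (q - y) \<le> c / 60 * e \<longrightarrow> (\<exists>u\<in>K. norm (q - u) \<le> 2 * \<delta> * norm u))"
    proof (cases "4 * \<delta> * norm u \<le> e")
      \<comment> \<open>Coarse scales inherit their ball from \<open>K\<close>, fine scales get it from the thickening.\<close>
      case True
      define \<epsilon>' where "\<epsilon>' = e / (60 * norm u)"
      have \<epsilon>': "0 < \<epsilon>'" "\<epsilon>' \<le> s" "\<epsilon>' * norm u = e / 60"
        using e_pos e_le u_pos by (auto simp: \<epsilon>'_def field_simps)
      obtain y where y: "y \<in> W" "norm (y - u) \<le> e / 60"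
          "\<forall>q\<in>W. norm (q - y) \<le> c * (e / 60) \<longrightarrow> q \<in> K"
        using KD(8)[OF z(3) \<epsilon>'(1,2)] \<epsilon>'(3) by (auto simp: mult.assoc)
      have "norm (y - z) \<le> norm (y - u) + norm (u - z)" using norm_triangle_ineq[of "y - u" "u - z"] by simp
      also have "\<dots> \<le> e" using y(2) z(4) True e_pos by (simp add: norm_minus_commute)
      finally have "norm (y - z) \<le> e" .
      moreover have "\<exists>u\<in>K. norm (q - u) \<le> 2 * \<delta> * norm u" if "q \<in> W" "norm (q - y) \<le> c / 60 * e" for q
        using y(3) that \<delta> by (intro bexI[of _ q]) auto
      ultimately show ?thesis using y(1) by blast
    next
      case False
      \<comment> \<open>Moving from \<open>z\<close> towards \<open>u\<close> by this fraction
        brings \<open>y\<close> at least \<open>e / 2\<close> inside the ball of radius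
        \<open>2 * \<delta> * norm u\<close> around \<open>u\<close>, which leaves room for the
        required ball.\<close>
      define l where "l = e / (4 * \<delta> * norm u)"
      have l: "0 < l" "l \<le> 1" "l * (2 * \<delta> * norm u) = e / 2"
        using e_pos u_pos \<delta> False by (auto simp: l_def field_simps)
      define y where "y = z + l *\<^sub>R (u - z)"
      have yW: "y \<in> W" using W z KD(1) by (auto simp: y_def intro!: subspace_add subspace_scale subspace_diff)
      have "norm (y - z) = l * norm (z - u)" using l by (simp add: y_def norm_minus_commute)
      also have "\<dots> \<le> e / 2" using mult_left_mono[OF z(4), of l] l by simp
      finally have 1: "norm (y - z) \<le> e" using e_pos by simp
      have "norm (q - u) \<le> 2 * \<delta> * norm u" if q: "norm (q - y) \<le> c / 60 * e" for q
      proof -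
        have "y - u = (1 - l) *\<^sub>R (z - u)" by (simp add: y_def algebra_simps)
        then have "norm (y - u) = (1 - l) * norm (z - u)" using l by simp
        also have "\<dots> \<le> (1 - l) * (2 * \<delta> * norm u)" using z(4) l by (intro mult_left_mono) auto
        finally have "norm (y - u) \<le> 2 * \<delta> * norm u - e / 2" using l(3) by (simp add: algebra_simps)
        moreover have "c * e \<le> 1 * e" using c e_pos by (intro mult_right_mono) auto
        moreover have "norm (q - u) \<le> norm (q - y) + norm (y - u)"
          using norm_triangle_ineq[of "q - y" "y - u"] by simp
        ultimately show ?thesis using q e_pos by linarith
      qed
      then show ?thesis using 1 yW z(3) by blast
    qed
    then obtain y where y: "y \<in> W" "norm (y - z) \<le> e"
      "\<And>q. q \<in> W \<Longrightarrow> norm (q - y) \<le> c / 60 * e \<Longrightarrow> \<exists>u\<in>K. norm (q - u) \<le> 2 * \<delta> * norm u" by blast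
    show "\<exists>y\<in>?W'. norm (y - p) \<le> \<epsilon> * norm p \<and>
        (\<forall>q\<in>?W'. norm (q - y) \<le> c / 60 * \<epsilon> * norm p \<longrightarrow> q \<in> perp x ` ?N)"
    proof (intro bexI[of _ "perp x y"] conjI ballI impI)
      show "perp x y \<in> ?W'" using perp_in_subspace[OF W x(1) y(1)] perp_orthogonal[OF x(2)] by auto
      show "norm (perp x y - p) \<le> \<epsilon> * norm p"
        using norm_perp_le[OF x(2), of "y - z"] y(2) z(1) by (simp add: P.diff e_def)
      fix q assume q: "q \<in> ?W'" "norm (q - perp x y) \<le> c / 60 * \<epsilon> * norm p"
      \<comment> \<open>Lifting \<open>q\<close> to the height of \<open>y\<close> along
        \<open>x\<close> preserves its distance from the centre.\<close>
      have eq: "q + (y \<bullet> x) *\<^sub>R x - y = q - perp x y" by (simp add: perp_def)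
      have "norm (q + (y \<bullet> x) *\<^sub>R x - y) \<le> c / 60 * e"
        unfolding eq e_def using q(2) by (simp add: mult.assoc)
      moreover have "q + (y \<bullet> x) *\<^sub>R x \<in> W" using q(1) W x by (auto intro: subspace_add subspace_scale)
      ultimately obtain v where "v \<in> K" "norm (q + (y \<bullet> x) *\<^sub>R x - v) \<le> 2 * \<delta> * norm v" using y(3) by blast
      then show "q \<in> perp x ` ?N" using lift q(1) by blast
    qed
  qed
  then show ?thesis unfolding cone_nbhd_def by blast
qed

section \<open>Perturbing a subspace onto many cones\<close>

lemma pigeonhole_card_mult:
  assumes "finite G" "finite X" "f ` G \<subseteq> X" "G \<noteq> {}"
  shows "\<exists>x\<in>X. card G \<le> card X * card {b \<in> G. f b = x}"
proof (rule ccontr)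
  assume "\<not> ?thesis"
  then have less: "card X * card {b \<in> G. f b = x} < card G" if "x \<in> X" for x
    using that by (meson not_le)
  have "X \<noteq> {}" using assms by auto
  have "G = (\<Union>x\<in>X. {b \<in> G. f b = x})" using assms(3) by auto
  then have "card G = (\<Sum>x\<in>X. card {b \<in> G. f b = x})"
    using assms(1,2) by (subst card_UN_disjoint[symmetric]) auto
  then have "card X * card G = (\<Sum>x\<in>X. card X * card {b \<in> G. f b = x})"
    by (simp add: sum_distrib_left)
  also have "\<dots> < (\<Sum>x\<in>X. card G)"
    using less assms(2) \<open>X \<noteq> {}\<close> by (intro sum_strict_mono) auto
  finally show False by simp
qed

text \<open>A finite net of the ball together with the finite set \<open>Basis\<close> gives
  boundedly many classes. The bound \<open>N\<close> is fixed before \<open>G\<close>, so the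
  retained fraction is uniform over all finite families.\<close>

lemma pigeonhole_cball:
  fixes R \<eta> :: real
  assumes "0 < \<eta>"
  shows "\<exists>N>0. \<forall>(G :: 'i set) (e :: 'i \<Rightarrow> 'a::euclidean_space) v.
    finite G \<longrightarrow> G \<noteq> {} \<longrightarrow> (\<forall>b\<in>G. e b \<in> Basis \<and> norm (v b :: 'a) \<le> R) \<longrightarrow>
    (\<exists>G'\<subseteq>G. card G \<le> N * card G' \<and> (\<forall>b\<in>G'. \<forall>b'\<in>G'. e b = e b' \<and> norm (v b - v b') \<le> \<eta>))"
proof -
  have "compact (cball (0::'a) R)" by simp
  then obtain X where X: "finite X" "cball (0::'a) R \<subseteq> (\<Union>x\<in>X. ball x (\<eta> / 2))"
    using assms unfolding compact_eq_totally_bounded by (metis half_gt_zero)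
  \<comment> \<open>The added \<open>1\<close> keeps \<open>N\<close> positive even if the net is
    empty, as it may be for negative \<open>R\<close>.\<close>
  define N where "N = card ((Basis :: 'a set) \<times> X) + 1"
  show ?thesis
  proof (intro exI[of _ N] conjI allI impI)
    show "0 < N" by (simp add: N_def)
    fix G :: "'i set" and e v :: "'i \<Rightarrow> 'a"
    assume G: "finite G" "G \<noteq> {}" and ev: "\<forall>b\<in>G. e b \<in> Basis \<and> norm (v b) \<le> R"
    have "\<forall>b\<in>G. \<exists>x\<in>X. dist x (v b) < \<eta> / 2"
    proof
      fix b assume "b \<in> G"
      then have "v b \<in> cball 0 R" using ev by simp
      then have "v b \<in> (\<Union>x\<in>X. ball x (\<eta> / 2))" using X(2) by blast
      then show "\<exists>x\<in>X. dist x (v b) < \<eta> / 2" by (simp only: UN_iff mem_ball)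
    qed
    then obtain h where h: "\<And>b. b \<in> G \<Longrightarrow> h b \<in> X \<and> dist (h b) (v b) < \<eta> / 2" by metis
    have "(\<lambda>b. (e b, h b)) ` G \<subseteq> Basis \<times> X" "finite ((Basis :: 'a set) \<times> X)" using h ev X(1) by auto
    then obtain a where a: "card G \<le> card ((Basis :: 'a set) \<times> X) * card {b \<in> G. (e b, h b) = a}"
      using pigeonhole_card_mult[OF G(1) _ _ G(2)] by blast
    show "\<exists>G'\<subseteq>G. card G \<le> N * card G' \<and>
        (\<forall>b\<in>G'. \<forall>b'\<in>G'. e b = e b' \<and> norm (v b - v b') \<le> \<eta>)"
    proof (intro exI[of _ "{b \<in> G. (e b, h b) = a}"] conjI ballI)
      show "card G \<le> N * card {b \<in> G. (e b, h b) = a}" using a by (simp add: N_def)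
      fix b b' assume "b \<in> {b \<in> G. (e b, h b) = a}" "b' \<in> {b \<in> G. (e b, h b) = a}"
      then have b: "b \<in> G" "b' \<in> G" "e b = e b'" "h b = h b'" by auto
      then show "e b = e b'" by simp
      show "norm (v b - v b') \<le> \<eta>"
        using h[OF b(1)] h[OF b(2)] b(4) dist_triangle_half_r[of "h b" "v b" \<eta> "v b'"]
        by (simp add: dist_norm)
    qed auto
  qed
qed

text \<open>The displacements needed are of order \<open>\<delta>\<close>; divided by
  \<open>\<delta>\<close> they lie in a fixed compact set, and one finite net serves all scales.
  Hence \<open>\<beta>\<close> is chosen before \<open>\<delta>\<close>, \<open>W\<close> and
  \<open>V\<close>. The points \<open>p\<close> are taken in \<open>W\<close> because interior balls
  are relative to \<open>W\<close>.\<close>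

lemma shift_transversal:
  assumes c: "0 < c"
  shows "\<exists>\<beta>>0. \<forall>(G :: 'i set) W (D :: 'i \<Rightarrow> 'a::euclidean_space set) s \<delta> V.
     finite G \<longrightarrow> subspace W \<longrightarrow> subspace V \<longrightarrow> 0 < \<delta> \<longrightarrow>
     (\<forall>b\<in>G. fat_cone c W (s b) (D b) \<and> \<delta> \<le> s b \<and>
        (\<exists>p\<in>V \<inter> W. \<exists>u\<in>D b. norm u = 1 \<and> 1 / 2 \<le> norm p \<and> norm (p - u) \<le> 16 * \<delta>)) \<longrightarrow>
     (\<exists>G'\<subseteq>G. \<beta> * real (card G) \<le> real (card G') \<and>
        (\<exists>V'. subspace V' \<and> dim V' \<le> dim V \<and> (\<forall>b\<in>G'. V' \<inter> D b \<noteq> {})))"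
proof -
  define n where "n = real DIM('a)"
  have n: "0 < n" by (simp add: n_def)
  have c17: "0 < c / 17" using c by simp
  obtain N where N: "0 < N" "\<forall>(G :: 'i set) (e :: 'i \<Rightarrow> 'a) (v :: 'i \<Rightarrow> 'a). finite G \<longrightarrow> G \<noteq> {} \<longrightarrow>
      (\<forall>b\<in>G. e b \<in> Basis \<and> norm (v b) \<le> 34 * n) \<longrightarrow>
      (\<exists>G'\<subseteq>G. card G \<le> N * card G' \<and> (\<forall>b\<in>G'. \<forall>b'\<in>G'. e b = e b' \<and> norm (v b - v b') \<le> c / 17))"
    using pigeonhole_cball[OF c17, where ?'i = 'i and ?'a = 'a and R = "34 * n"]
    by (elim exE conjE) (rule that)
  show ?thesis
  proof (intro exI[of _ "1 / real N"] conjI allI impI)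
    show "0 < 1 / real N" using N by simp
    fix G :: "'i set" and W V :: "'a set" and D s and \<delta> :: real
    assume G: "finite G" and W: "subspace W" and V: "subspace V" and \<delta>: "0 < \<delta>"
      and D: "\<forall>b\<in>G. fat_cone c W (s b) (D b) \<and> \<delta> \<le> s b \<and>
        (\<exists>p\<in>V \<inter> W. \<exists>u\<in>D b. norm u = 1 \<and> 1 / 2 \<le> norm p \<and> norm (p - u) \<le> 16 * \<delta>)"
    show "\<exists>G'\<subseteq>G. 1 / real N * real (card G) \<le> real (card G') \<and>
        (\<exists>V'. subspace V' \<and> dim V' \<le> dim V \<and> (\<forall>b\<in>G'. V' \<inter> D b \<noteq> {}))"
    proof (cases "G = {}")
      case True
      then show ?thesis using V by auto
    next
      case False
      have "\<forall>b\<in>G. \<exists>p y e. p \<in> V \<inter> W \<and> norm p \<le> 17 \<and> y \<in> W \<and> e \<in> Basis \<and> p \<bullet> e \<noteq> 0 \<and>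
         norm ((1 / (\<delta> * (p \<bullet> e))) *\<^sub>R (y - p)) \<le> 34 * n \<and> (\<forall>z\<in>W. norm (z - y) \<le> c * \<delta> \<longrightarrow> z \<in> D b)"
      proof
        fix b assume b: "b \<in> G"
        then have fb: "fat_cone c W (s b) (D b)" "\<delta> \<le> s b" using D by auto
        then have \<delta>1: "\<delta> \<le> 1" using fat_coneD(5) by fastforce
        obtain p u where p: "p \<in> V \<inter> W" "u \<in> D b" "norm u = 1" "1 / 2 \<le> norm p" "norm (p - u) \<le> 16 * \<delta>"
          using D b by blast
        have p17: "norm p \<le> 17" using norm_triangle_ineq2[of p u] p \<delta>1 by linarith
        obtain y where y: "y \<in> W" "norm (y - u) \<le> \<delta>" "\<forall>z\<in>W. norm (z - y) \<le> c * \<delta> \<longrightarrow> z \<in> D b"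
          using fat_coneD(8)[OF fb(1) p(2) \<delta> fb(2)] p(3) by auto
        have "norm (y - p) \<le> norm (y - u) + norm (u - p)" using norm_triangle_ineq[of "y - u" "u - p"] by simp
        then have yp: "norm (y - p) \<le> 17 * \<delta>" using y(2) p(5) by (simp add: norm_minus_commute)
        \<comment> \<open>Otherwise the absolute coordinates of \<open>p\<close> would sum to less
          than \<open>1 / 2\<close>. A coordinate bounded away from \<open>0\<close> bounds the
          rescaled shift by \<open>17 * (2 * n)\<close>.\<close>
        have "\<exists>e\<in>Basis. 1 / (2 * n) \<le> \<bar>p \<bullet> e\<bar>"
        proof (rule ccontr)
          assume "\<not> ?thesis"
          then have "(\<Sum>e\<in>Basis. \<bar>p \<bullet> e\<bar>) < (\<Sum>e\<in>(Basis::'a set). 1 / (2 * n))"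
            by (intro sum_strict_mono) auto
          also have "\<dots> = 1 / 2" using n by (simp add: n_def)
          finally show False using norm_le_l1[of p] p(4) by linarith
        qed
        then obtain e where e: "e \<in> Basis" "1 / (2 * n) \<le> \<bar>p \<bullet> e\<bar>" by blast
        have pe: "p \<bullet> e \<noteq> 0" using e(2) n by auto
        have "norm (y - p) * 1 \<le> 17 * \<delta> * (2 * n * \<bar>p \<bullet> e\<bar>)"
          using e(2) n \<delta> yp by (intro mult_mono) (auto simp: field_simps)
        then have "norm (y - p) / (\<delta> * \<bar>p \<bullet> e\<bar>) \<le> 34 * n"
          using pe \<delta> by (simp add: field_simps)
        then have "norm ((1 / (\<delta> * (p \<bullet> e))) *\<^sub>R (y - p)) \<le> 34 * n"
          using \<delta> by (simp add: abs_mult)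
        then show "\<exists>p y e. p \<in> V \<inter> W \<and> norm p \<le> 17 \<and> y \<in> W \<and> e \<in> Basis \<and> p \<bullet> e \<noteq> 0 \<and>
         norm ((1 / (\<delta> * (p \<bullet> e))) *\<^sub>R (y - p)) \<le> 34 * n \<and> (\<forall>z\<in>W. norm (z - y) \<le> c * \<delta> \<longrightarrow> z \<in> D b)"
          using p(1) p17 y(1,3) e(1) pe by blast
      qed
      then obtain p y e where pye: "\<And>b. b \<in> G \<Longrightarrow> p b \<in> V \<inter> W \<and> norm (p b) \<le> 17 \<and> y b \<in> W \<and>
          e b \<in> Basis \<and> p b \<bullet> e b \<noteq> 0 \<and> norm ((1 / (\<delta> * (p b \<bullet> e b))) *\<^sub>R (y b - p b)) \<le> 34 * n \<and>
          (\<forall>z\<in>W. norm (z - y b) \<le> c * \<delta> \<longrightarrow> z \<in> D b)"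
        by metis
      \<comment> \<open>The map \<open>q \<mapsto> q + \<delta> (q \<bullet> e b) v b\<close> moves \<open>p b\<close> to the ball centre \<open>y b\<close>; its data range over a
        fixed compact set, so by the pigeonhole principle one map serves many \<open>b\<close>.\<close>
      define v where "v = (\<lambda>b. (1 / (\<delta> * (p b \<bullet> e b))) *\<^sub>R (y b - p b))"
      have "\<forall>b\<in>G. e b \<in> Basis \<and> norm (v b) \<le> 34 * n" using pye by (auto simp: v_def)
      from N(2)[THEN spec, THEN spec, THEN spec, THEN mp, OF G, THEN mp, OF False, THEN mp, OF this]
      obtain G' where G': "G' \<subseteq> G" "card G \<le> N * card G'"
        "\<And>b b'. b \<in> G' \<Longrightarrow> b' \<in> G' \<Longrightarrow> e b = e b' \<and> norm (v b - v b') \<le> c / 17" by blast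
      have "G' \<noteq> {}" using G'(2) G False by auto
      then obtain a where a: "a \<in> G'" by blast
      define T where "T = (\<lambda>q. q + (q \<bullet> e a) *\<^sub>R (\<delta> *\<^sub>R v a))"
      have T: "linear T" unfolding T_def by (rule linearI) (simp_all add: algebra_simps inner_simps)
      have hit: "T (p b) \<in> T ` V \<inter> D b" if b: "b \<in> G'" for b
      proof
        note pb = pye[OF subsetD[OF G'(1) b]] and pa = pye[OF subsetD[OF G'(1) a]]
        show "T (p b) \<in> T ` V" using pb by blast
        have "v a \<in> W" using pa W by (auto simp: v_def intro!: subspace_scale subspace_diff)
        then have TW: "T (p b) \<in> W" using pb W by (auto simp: T_def intro!: subspace_add subspace_scale)
        have eb: "e b = e a" using G'(3)[OF b a] by simp
        have "y b = p b + (p b \<bullet> e a) *\<^sub>R (\<delta> *\<^sub>R v b)" using pb \<delta> eb by (simp add: v_def)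
        then have "T (p b) - y b = ((p b \<bullet> e a) * \<delta>) *\<^sub>R (v a - v b)"
          by (simp add: T_def algebra_simps)
        then have "norm (T (p b) - y b) = \<bar>p b \<bullet> e a\<bar> * \<delta> * norm (v a - v b)" using \<delta> by (simp add: abs_mult)
        \<comment> \<open>The pigeonhole tolerance \<open>c / 17\<close> was chosen for this
          estimate: the error is at most the radius \<open>c * \<delta>\<close> of the ball around
          \<open>y b\<close>.\<close>
        also have "\<dots> \<le> 17 * \<delta> * (c / 17)"
        proof (intro mult_mono)
          show "\<bar>p b \<bullet> e a\<bar> \<le> 17" using Basis_le_norm[of "e a" "p b"] pa pb by auto
        qed (use \<delta> G'(3)[OF a b] in auto)
        finally show "T (p b) \<in> D b" using pb TW by (simp add: mult.commute)
      qed
      have "subspace (T ` V)" "dim (T ` V) \<le> dim V"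
        using V T linear_subspace_image dim_image_le by blast+
      moreover have "real (card G) \<le> real N * real (card G')"
        using of_nat_mono[OF G'(2), where ?'a = real] by simp
      then have "1 / real N * real (card G) \<le> real (card G')"
        using N(1) by (simp add: divide_le_eq mult.commute)
      ultimately show ?thesis using G'(1) hit by (intro exI[of _ G'] conjI exI[of _ "T ` V"]) blast+
    qed
  qed
qed

section \<open>Dense sets of colorful selections\<close>

lemma card_PiE_slice:
  assumes J: "finite J" "\<And>j. j \<in> J \<Longrightarrow> finite (I j)" "j \<in> J" "B \<subseteq> I j"
  shows "card {f \<in> PiE J I. f j \<in> B} = card B * (\<Prod>l\<in>J - {j}. card (I l))"
proof -
  have "{f \<in> PiE J I. f j \<in> B} = PiE J (I(j := B))"
  proof (intro set_eqI iffI)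
    fix f assume "f \<in> {f \<in> PiE J I. f j \<in> B}"
    then show "f \<in> PiE J (I(j := B))" by (simp add: PiE_iff)
  next
    fix f assume f: "f \<in> PiE J (I(j := B))"
    then have *: "f i \<in> (I(j := B)) i" if "i \<in> J" for i using that by (rule PiE_mem)
    have fj: "f j \<in> B" using *[OF J(3)] by simp
    have "f i \<in> I i" if "i \<in> J" for i
      using *[OF that] fj J(4) by (cases "i = j") auto
    then show "f \<in> {f \<in> PiE J I. f j \<in> B}" using f fj by (simp add: PiE_iff)
  qed
  then have "card {f \<in> PiE J I. f j \<in> B} = (\<Prod>l\<in>J. card ((I(j := B)) l))"
    using J(1) by (simp add: card_PiE)
  also have "\<dots> = card B * (\<Prod>l\<in>J - {j}. card (I l))"
    using J(1,3) by (subst prod.remove[of J j]) auto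
  finally show ?thesis .
qed

lemma dense_color:
  assumes J: "finite J" "J \<noteq> {}" and S: "finite S" "\<And>f. f \<in> S \<Longrightarrow> \<exists>i\<in>J. R i f"
  shows "\<exists>i\<in>J. real (card S) \<le> card J * real (card {f \<in> S. R i f})"
proof (cases "S = {}")
  case True then show ?thesis using J by auto
next
  case False
  obtain h where h: "\<And>f. f \<in> S \<Longrightarrow> h f \<in> J \<and> R (h f) f" using S(2) by metis
  obtain i where i: "i \<in> J" "card S \<le> card J * card {f \<in> S. h f = i}"
    using pigeonhole_card_mult[of S J h] J S False h by auto
  have "card {f \<in> S. h f = i} \<le> card {f \<in> S. R i f}" using S(1) h by (intro card_mono) auto
  then have "card S \<le> card J * card {f \<in> S. R i f}" using i(2) mult_le_mono2 order_trans by blast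
  then show ?thesis using i(1) by (metis of_nat_le_iff of_nat_mult)
qed

text \<open>Averaging over the value at \<open>i\<close>: if every fibre were thinner than claimed,
  the fibres could not add up to \<open>S\<close>. They are stated as functions on
  \<open>J - {i}\<close>, the form in which the induction uses them.\<close>

lemma dense_slice:
  fixes \<alpha> :: real
  assumes J: "finite J" "\<And>j. j \<in> J \<Longrightarrow> finite (I j)" "i \<in> J" "I i \<noteq> {}" and S: "S \<subseteq> PiE J I"
    and dense: "\<alpha> * (\<Prod>j\<in>J. real (card (I j))) \<le> real (card S)"
  shows "\<exists>a\<in>I i. \<alpha> * (\<Prod>j\<in>J - {i}. real (card (I j))) \<le>
    real (card {g \<in> PiE (J - {i}) I. g(i := a) \<in> S})"
proof -
  have finS: "finite S" using S J finite_PiE finite_subset by meson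
  show ?thesis
  proof (rule ccontr)
    assume neg: "\<not> ?thesis"
    have le: "card {f \<in> S. f i = a} \<le> card {g \<in> PiE (J - {i}) I. g(i := a) \<in> S}" for a
    \<comment> \<open>Restriction to \<open>J - {i}\<close> amounts to resetting the value at
      \<open>i\<close> to \<open>undefined\<close>, as extensionality demands.\<close>
    proof (rule card_inj_on_le[of "\<lambda>f. f(i := undefined)"])
      show "inj_on (\<lambda>f. f(i := undefined)) {f \<in> S. f i = a}"
      proof (rule inj_onI)
        fix f g assume "f \<in> {f \<in> S. f i = a}" "g \<in> {f \<in> S. f i = a}" "f(i := undefined) = g(i := undefined)"
        then have "f x = g x" for x by (cases "x = i") (auto simp: fun_eq_iff split: if_splits)
        then show "f = g" by blast
      qed
      show "(\<lambda>f. f(i := undefined)) ` {f \<in> S. f i = a} \<subseteq> {g \<in> PiE (J - {i}) I. g(i := a) \<in> S}"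
      proof clarify
        fix f assume f: "f \<in> S"
        then have "f \<in> PiE J I" using S by blast
        then show "f(i := undefined) \<in> PiE (J - {i}) I \<and> f(i := undefined, i := f i) \<in> S"
          using f by (simp add: PiE_iff extensional_def)
      qed
      have "finite (PiE (J - {i}) I)" using J by (intro finite_PiE) auto
      then show "finite {g \<in> PiE (J - {i}) I. g(i := a) \<in> S}" by simp
    qed
    have less: "real (card {f \<in> S. f i = a}) < \<alpha> * (\<Prod>j\<in>J - {i}. real (card (I j)))" if "a \<in> I i" for a
    proof -
      have "\<not> \<alpha> * (\<Prod>j\<in>J - {i}. real (card (I j))) \<le> real (card {g \<in> PiE (J - {i}) I. g(i := a) \<in> S})"
        using neg that by blast
      then show ?thesis using of_nat_mono[OF le[of a], where ?'a = real] by linarith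
    qed
    have "S = (\<Union>a\<in>I i. {f \<in> S. f i = a})" using S J(3) by auto
    then have "card S = (\<Sum>a\<in>I i. card {f \<in> S. f i = a})"
      using finS J(2,3) by (subst card_UN_disjoint[symmetric]) auto
    then have "real (card S) = (\<Sum>a\<in>I i. real (card {f \<in> S. f i = a}))" by simp
    also have "\<dots> < (\<Sum>a\<in>I i. \<alpha> * (\<Prod>j\<in>J - {i}. real (card (I j))))"
      using J less by (intro sum_strict_mono) auto
    also have "\<dots> = \<alpha> * (\<Prod>j\<in>J. real (card (I j)))"
      using J(1,3) by (simp add: prod.remove)
    finally show False using dense by simp
  qed
qed

text \<open>Union bound: each index \<open>j\<close> accounts for at most a fraction
  \<open>\<alpha> / (2 * card J)\<close> of all selections, hence at most
  \<open>\<alpha> / 2\<close> is lost altogether.\<close>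

lemma dense_avoid:
  fixes \<alpha> :: real
  assumes J: "finite J" "\<And>j. j \<in> J \<Longrightarrow> finite (I j)" "J \<noteq> {}" and H: "H \<subseteq> PiE J I"
    and dense: "\<alpha> * (\<Prod>j\<in>J. real (card (I j))) \<le> real (card H)"
    and B: "\<And>j. j \<in> J \<Longrightarrow> B j \<subseteq> I j \<and> real (card (B j)) \<le> \<alpha> / (2 * card J) * real (card (I j))"
  shows "\<alpha> / 2 * (\<Prod>j\<in>J. real (card (I j))) \<le> real (card {f \<in> H. \<forall>j\<in>J. f j \<notin> B j})"
proof -
  define p where "p = (\<Prod>j\<in>J. real (card (I j)))"
  have finP: "finite (PiE J I)" using J by (intro finite_PiE) auto
  have J0: "0 < real (card J)" using J by (simp add: card_gt_0_iff)
  have "real (card H) \<le> real (card ({f \<in> H. \<forall>j\<in>J. f j \<notin> B j} \<union> (\<Union>j\<in>J. {f \<in> PiE J I. f j \<in> B j})))"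
    using H finP J(1) finite_subset[OF H] by (intro of_nat_mono card_mono) auto
  also have "\<dots> \<le> real (card {f \<in> H. \<forall>j\<in>J. f j \<notin> B j} + card (\<Union>j\<in>J. {f \<in> PiE J I. f j \<in> B j}))"
    by (intro of_nat_mono card_Un_le)
  also have "\<dots> \<le> real (card {f \<in> H. \<forall>j\<in>J. f j \<notin> B j}) + (\<Sum>j\<in>J. real (card {f \<in> PiE J I. f j \<in> B j}))"
    using card_UN_le[OF J(1), of "\<lambda>j. {f \<in> PiE J I. f j \<in> B j}"] by (simp flip: of_nat_sum)
  also have "(\<Sum>j\<in>J. real (card {f \<in> PiE J I. f j \<in> B j})) \<le> (\<Sum>j\<in>J. \<alpha> / (2 * card J) * p)"
  proof (rule sum_mono)
    fix j assume j: "j \<in> J"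
    have "real (card {f \<in> PiE J I. f j \<in> B j}) = real (card (B j)) * (\<Prod>l\<in>J - {j}. real (card (I l)))"
      using card_PiE_slice[where B = "B j", OF J(1,2) j] B[OF j] by simp
    also have "\<dots> \<le> \<alpha> / (2 * card J) * real (card (I j)) * (\<Prod>l\<in>J - {j}. real (card (I l)))"
      using B[OF j] by (intro mult_right_mono prod_nonneg) auto
    also have "\<dots> = \<alpha> / (2 * card J) * p" using J(1) j by (simp add: p_def prod.remove)
    finally show "real (card {f \<in> PiE J I. f j \<in> B j}) \<le> \<alpha> / (2 * card J) * p" .
  qed
  also have "\<dots> = \<alpha> / 2 * p" using J0 by simp
  finally show ?thesis using dense by (simp add: p_def)
qed

section \<open>Fractional Helly for fat double cones\<close>

definition cone_transversal :: "nat \<Rightarrow> 'a::euclidean_space set set \<Rightarrow> bool" where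
  "cone_transversal m \<D> \<longleftrightarrow> (\<exists>V. subspace V \<and> dim V \<le> m \<and> (\<forall>K\<in>\<D>. V \<inter> K \<noteq> {}))"

section \<open>Passing transversals to the projection and back\<close>

lemma cone_transversalE:
  assumes "cone_transversal m \<D>"
  obtains V where "subspace V" "dim V \<le> m" "\<forall>K\<in>\<D>. V \<inter> K \<noteq> {}"
  using assms unfolding cone_transversal_def by blast

text \<open>A subspace meeting \<open>A\<close>, a cone of size \<open>\<delta>\<close> containing
  \<open>x\<close>, has a point within \<open>\<delta>\<close> of \<open>x\<close>. A small linear
  perturbation turns it into one through \<open>x\<close>, still meeting the thickened cones, and
  projection along \<open>x\<close> then saves one dimension.\<close>

lemma transversal_project:
  assumes A: "fat_cone c W \<delta> A" "\<delta> \<le> 1 / 2" and x: "x \<in> A" "norm x = 1" and W: "subspace W"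
    and \<D>: "\<And>K. K \<in> \<D> \<Longrightarrow> K \<subseteq> W"
    and tr: "cone_transversal (Suc m) (insert A \<D>)"
  shows "cone_transversal m ((\<lambda>K. perp x ` cone_nbhd W \<delta> K) ` \<D>)"
proof -
  note AD = fat_coneD[OF A(1)]
  obtain V where V: "subspace V" "dim V \<le> Suc m" "\<forall>K\<in>insert A \<D>. V \<inter> K \<noteq> {}"
    using tr by (elim cone_transversalE)
  obtain p0 where p0: "p0 \<in> V" "p0 \<in> A" using V(3) by blast
  obtain t where t: "norm (t *\<^sub>R p0 - x) \<le> \<delta>" using AD(7)[OF p0(2) x(1)] x(2) by auto
  define p where "p = t *\<^sub>R p0"
  have pV: "p \<in> V" using p0 V(1) by (simp add: p_def subspace_scale)
  have pW: "p \<in> W" using p0 AD(1) W by (auto simp: p_def intro: subspace_scale)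
  have px: "norm (x - p) \<le> \<delta>" using t by (simp add: p_def norm_minus_commute)
  have np: "1 / 2 \<le> norm p" using norm_triangle_ineq2[of x "x - p"] px x(2) A(2) by simp
  have pp: "p \<bullet> p \<noteq> 0" using np by auto
  \<comment> \<open>A linear map that is within \<open>2 \<delta>\<close> of the identity and moves \<open>p\<close> to \<open>x\<close>.\<close>
  define T where "T = (\<lambda>q. q + ((q \<bullet> p) / (p \<bullet> p)) *\<^sub>R (x - p))"
  have T: "linear T" unfolding T_def
    by (rule linearI) (simp_all add: algebra_simps inner_simps add_divide_distrib)
  have Tp: "T p = x" using pp by (simp add: T_def)
  have T_near: "norm (T q - q) \<le> 2 * \<delta> * norm q" for q
  proof -
    have "norm (T q - q) = \<bar>q \<bullet> p\<bar> / (norm p)\<^sup>2 * norm (x - p)"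
      by (simp add: T_def power2_norm_eq_inner)
    also have "\<dots> \<le> (norm q * norm p) / (norm p)\<^sup>2 * \<delta>"
      using px by (intro mult_mono divide_right_mono Cauchy_Schwarz_ineq2) auto
    also have "\<dots> = norm q * \<delta> * (1 / norm p)" by (simp add: power2_eq_square)
    also have "\<dots> \<le> norm q * \<delta> * 2"
    proof (intro mult_left_mono)
      show "1 / norm p \<le> 2" using np by (subst pos_divide_le_eq) auto
    qed (use AD(4) in auto)
    finally show ?thesis by (simp add: mult_ac)
  qed
  have TV: "subspace (T ` V)" "dim (T ` V) \<le> dim V" "x \<in> T ` V"
    using V(1) T linear_subspace_image dim_image_le Tp pV by blast+
  have "subspace (perp x ` T ` V)" using TV(1) linear_perp linear_subspace_image by blast
  moreover have "dim (perp x ` T ` V) \<le> m"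
    using dim_perp_image_less[OF TV(1,3) x(2)] TV(2) V(2) by linarith
  moreover have "perp x ` T ` V \<inter> perp x ` cone_nbhd W \<delta> K \<noteq> {}" if K: "K \<in> \<D>" for K
  proof -
    obtain u where u: "u \<in> V" "u \<in> K" using V(3) K by blast
    have "u \<in> W" using \<D>[OF K] u by blast
    then have "T u \<in> W" using pW AD(1) x(1) W
      by (auto simp: T_def intro!: subspace_add subspace_scale subspace_diff)
    then have "T u \<in> cone_nbhd W \<delta> K" using u(2) T_near unfolding cone_nbhd_def by blast
    then show ?thesis using u(1) by blast
  qed
  ultimately show ?thesis unfolding cone_transversal_def by (intro exI[of _ "perp x ` T ` V"]) blast
qed

text \<open>Adjoining \<open>x\<close> to \<open>V\<close> recovers a point \<open>z\<close> of the
  thickened cone from its projection. Normalising \<open>u\<close> leaves an error of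
  \<open>2 * \<delta>\<close>, relaxed to \<open>16 * \<delta>\<close> to match
  \<open>transversal_pole\<close>.\<close>

lemma transversal_lift:
  assumes K: "fat_cone c W s K" and W: "subspace W" and x: "x \<in> W" and \<delta>: "0 < \<delta>" "\<delta> \<le> 1 / 4"
    and w: "w \<in> V" "w \<in> perp x ` cone_nbhd W \<delta> K"
  shows "\<exists>p\<in>span (insert x V) \<inter> W. \<exists>u\<in>K. norm u = 1 \<and> 1 / 2 \<le> norm p \<and> norm (p - u) \<le> 16 * \<delta>"
proof -
  note KD = fat_coneD[OF K]
  obtain z u where z: "w = perp x z" "z \<in> W" "u \<in> K" "norm (z - u) \<le> 2 * \<delta> * norm u"
    using w(2) by (auto simp: cone_nbhd_def)
  have zs: "z \<in> span (insert x V)"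
  proof -
    have "z = w + (z \<bullet> x) *\<^sub>R x" by (simp add: z(1) perp_def)
    moreover have "w + (z \<bullet> x) *\<^sub>R x \<in> span (insert x V)"
      using w(1) by (intro span_add span_scale span_base) auto
    ultimately show ?thesis by simp
  qed
  have u: "norm u \<noteq> 0" using KD(2) z(3) by auto
  define t where "t = inverse (norm u)"
  have t: "0 < t" "t * norm u = 1" using u by (auto simp: t_def)
  have tu: "t *\<^sub>R u \<in> K" "norm (t *\<^sub>R u) = 1" using KD(6)[OF z(3)] t by auto
  have "norm (t *\<^sub>R z - t *\<^sub>R u) = t * norm (z - u)" using t by (simp flip: scaleR_diff_right)
  also have "\<dots> \<le> t * (2 * \<delta> * norm u)" using z(4) t by (intro mult_left_mono) auto
  also have "\<dots> = 2 * \<delta>" using t(2) by simp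
  finally have near: "norm (t *\<^sub>R z - t *\<^sub>R u) \<le> 2 * \<delta>" .
  then have "1 / 2 \<le> norm (t *\<^sub>R z)"
    using norm_triangle_ineq2[of "t *\<^sub>R u" "t *\<^sub>R u - t *\<^sub>R z"] tu(2) \<delta> norm_minus_commute[of "t *\<^sub>R z" "t *\<^sub>R u"] by simp
  moreover have "t *\<^sub>R z \<in> span (insert x V) \<inter> W" using zs z(2) W by (auto intro: span_scale subspace_scale)
  ultimately show ?thesis using tu near \<delta> by (intro bexI[of _ "t *\<^sub>R z"] bexI[of _ "t *\<^sub>R u"]) auto
qed

text \<open>Handles the cones that are too close to the line through \<open>x\<close> to be
  projected: by \<open>near_pole\<close>, the bound \<open>8 * \<delta>\<close> on the projection
  puts \<open>x\<close> or \<open>- x\<close> within \<open>16 * \<delta>\<close>.\<close>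

lemma transversal_pole:
  assumes K: "fat_cone c W s K" and W: "subspace W" and x: "x \<in> W" "norm x = 1"
    and u: "u \<in> K" "norm (perp x u) \<le> 8 * \<delta> * norm u"
  shows "\<exists>p\<in>span {x} \<inter> W. \<exists>u\<in>K. norm u = 1 \<and> 1 / 2 \<le> norm p \<and> norm (p - u) \<le> 16 * \<delta>"
proof -
  note KD = fat_coneD[OF K]
  interpret P: linear "perp x" by (rule linear_perp)
  have un: "norm u \<noteq> 0" using KD(2) u(1) by auto
  define v where "v = inverse (norm u) *\<^sub>R u"
  have v: "v \<in> K" "norm v = 1" using KD(6)[OF u(1)] un by (auto simp: v_def)
  have "norm (perp x v) = inverse (norm u) * norm (perp x u)" by (simp add: v_def P.scale)
  also have "\<dots> \<le> inverse (norm u) * (8 * \<delta> * norm u)" using u(2) by (intro mult_left_mono) auto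
  also have "\<dots> = 8 * \<delta>" using un by simp
  finally have "norm (perp x v) \<le> 8 * \<delta>" .
  moreover obtain p where p: "p \<in> {x, - x}" "norm (p - v) \<le> 2 * norm (perp x v)"
    using near_pole[OF x(2) v(2)] by blast
  moreover have "p \<in> span {x} \<inter> W" "norm p = 1"
    using p(1) x W by (auto intro: span_base span_neg subspace_neg)
  ultimately show ?thesis using v by (intro bexI[of _ p] bexI[of _ v]) auto
qed

text \<open>Induction on \<open>m\<close> with \<open>c\<close> and \<open>\<alpha>\<close> free,
  since each step passes to \<open>c / 60\<close> and to a smaller density. \<open>\<beta>\<close>
  precedes \<open>W\<close> and the sizes \<open>s\<close>, hence is uniform in them. Cones are
  indexed through \<open>D\<close> because different cones may have equal projections and the counts
  must survive; \<open>J\<close> is an arbitrary index set so that a colour can be deleted.\<close>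

lemma fractional_helly_cones:
  assumes "0 < c" "c \<le> 1" "0 < \<alpha>"
  shows "\<exists>\<beta>>0. \<forall>W J (I :: nat \<Rightarrow> 'i set) (D :: 'i \<Rightarrow> 'a::euclidean_space set) s.
    subspace W \<longrightarrow> finite J \<longrightarrow> card J = Suc m \<longrightarrow>
    (\<forall>j\<in>J. finite (I j) \<and> I j \<noteq> {} \<and> (\<forall>b\<in>I j. fat_cone c W (s b) (D b))) \<longrightarrow>
    \<alpha> * (\<Prod>j\<in>J. real (card (I j))) \<le> real (card {f \<in> PiE J I. cone_transversal m (D ` f ` J)}) \<longrightarrow>
    (\<exists>j\<in>J. \<exists>G\<subseteq>I j. \<beta> * real (card (I j)) \<le> real (card G) \<and> cone_transversal m (D ` G))"
  using assms
proof (induction m arbitrary: c \<alpha>)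
  case 0
  show ?case
  proof (intro exI[of _ 1] conjI allI impI)
    fix W J and I :: "nat \<Rightarrow> 'i set" and D :: "'i \<Rightarrow> 'a set" and s
    assume J: "finite J" "card J = Suc 0"
      and I: "\<forall>j\<in>J. finite (I j) \<and> I j \<noteq> {} \<and> (\<forall>b\<in>I j. fat_cone c W (s b) (D b))"
      and dense: "\<alpha> * (\<Prod>j\<in>J. real (card (I j))) \<le> real (card {f \<in> PiE J I. cone_transversal 0 (D ` f ` J)})"
    have "0 < \<alpha> * (\<Prod>j\<in>J. real (card (I j)))"
      using I 0(3) by (intro mult_pos_pos prod_pos) (auto simp: card_gt_0_iff)
    then have "{f \<in> PiE J I. cone_transversal 0 (D ` f ` J)} \<noteq> {}" using dense by (metis card.empty not_le of_nat_0)
    then obtain f where f: "f \<in> PiE J I" "cone_transversal 0 (D ` f ` J)" by blast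
    obtain V where V: "subspace V" "dim V \<le> 0" "\<forall>K\<in>D ` f ` J. V \<inter> K \<noteq> {}"
      using f(2) by (elim cone_transversalE)
    obtain j where j: "j \<in> J" using J by fastforce
    \<comment> \<open>The zero subspace meets no fat cone, which contradicts the positive
      density.\<close>
    have "V \<subseteq> {0}" using V(2) by simp
    then have "0 \<in> D (f j)" using V(3) j by blast
    moreover have "fat_cone c W (s (f j)) (D (f j))" using I j f(1) by (blast dest: PiE_mem)
    ultimately have False using fat_coneD(2) by blast
    then show "\<exists>j\<in>J. \<exists>G\<subseteq>I j. 1 * real (card (I j)) \<le> real (card G) \<and> cone_transversal 0 (D ` G)" ..
  qed simp
next
  case (Suc m)
  \<comment> \<open>Fixing the colour of the smallest cone costs a factor \<open>m + 2\<close>. The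
    threshold \<open>\<tau>\<close> is the one for which \<open>dense_avoid\<close> with
    \<open>m + 1\<close> colours retains density \<open>\<alpha>1 / 2\<close>.\<close>
  define \<alpha>1 where "\<alpha>1 = \<alpha> / real (m + 2)"
  define \<tau> where "\<tau> = \<alpha>1 / (2 * real (Suc m))"
  have pos: "0 < \<alpha>1" "0 < \<alpha>1 / 2" "0 < \<tau>" using Suc.prems by (auto simp: \<alpha>1_def \<tau>_def)
  obtain \<beta>1 where \<beta>1: "0 < \<beta>1" and shift: "\<forall>(G :: 'i set) W (D :: 'i \<Rightarrow> 'a::euclidean_space set) s \<delta> V.
     finite G \<longrightarrow> subspace W \<longrightarrow> subspace V \<longrightarrow> 0 < \<delta> \<longrightarrow>
     (\<forall>b\<in>G. fat_cone c W (s b) (D b) \<and> \<delta> \<le> s b \<and>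
        (\<exists>p\<in>V \<inter> W. \<exists>u\<in>D b. norm u = 1 \<and> 1 / 2 \<le> norm p \<and> norm (p - u) \<le> 16 * \<delta>)) \<longrightarrow>
     (\<exists>G'\<subseteq>G. \<beta>1 * real (card G) \<le> real (card G') \<and>
        (\<exists>V'. subspace V' \<and> dim V' \<le> dim V \<and> (\<forall>b\<in>G'. V' \<inter> D b \<noteq> {})))"
    using shift_transversal[OF Suc.prems(1), where ?'i = 'i and ?'a = 'a] by (elim exE conjE) (rule that)
  have c60: "0 < c / 60" "c / 60 \<le> 1" using Suc.prems by auto
  obtain \<beta>2 where \<beta>2: "0 < \<beta>2" and IH: "\<forall>W J (I :: nat \<Rightarrow> 'i set) (D :: 'i \<Rightarrow> 'a::euclidean_space set) s.
    subspace W \<longrightarrow> finite J \<longrightarrow> card J = Suc m \<longrightarrow>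
    (\<forall>j\<in>J. finite (I j) \<and> I j \<noteq> {} \<and> (\<forall>b\<in>I j. fat_cone (c / 60) W (s b) (D b))) \<longrightarrow>
    \<alpha>1 / 2 * (\<Prod>j\<in>J. real (card (I j))) \<le> real (card {f \<in> PiE J I. cone_transversal m (D ` f ` J)}) \<longrightarrow>
    (\<exists>j\<in>J. \<exists>G\<subseteq>I j. \<beta>2 * real (card (I j)) \<le> real (card G) \<and> cone_transversal m (D ` G))"
    using Suc.IH[OF c60 pos(2)] by (elim exE conjE) (rule that)
  \<comment> \<open>One term per case: many cones near the poles, or the induction hypothesis
    applied to families that keep at least a fraction \<open>\<alpha>1 / 2\<close> of their
    members.\<close>
  define \<beta> where "\<beta> = min (\<beta>1 * \<tau>) (\<beta>1 * (\<beta>2 * (\<alpha>1 / 2)))"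
  show ?case
  proof (intro exI[of _ \<beta>] conjI allI impI)
    show "0 < \<beta>" using \<beta>1 \<beta>2 pos by (simp add: \<beta>_def)
    fix W J and I :: "nat \<Rightarrow> 'i set" and D :: "'i \<Rightarrow> 'a set" and s
    assume W: "subspace W" and J: "finite J" "card J = Suc (Suc m)"
      and I: "\<forall>j\<in>J. finite (I j) \<and> I j \<noteq> {} \<and> (\<forall>b\<in>I j. fat_cone c W (s b) (D b))"
      and dense: "\<alpha> * (\<Prod>j\<in>J. real (card (I j)))
        \<le> real (card {f \<in> PiE J I. cone_transversal (Suc m) (D ` f ` J)})"
    define S where "S = {f \<in> PiE J I. cone_transversal (Suc m) (D ` f ` J)}"
    have Jne: "J \<noteq> {}" using J(2) by auto
    have finS: "finite S" unfolding S_def using I J(1) by (simp add: finite_PiE)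
    have least: "\<exists>i\<in>J. \<forall>j\<in>J. s (f i) \<le> s (f j)" for f
      using arg_min_if_finite[OF J(1) Jne, of "\<lambda>j. s (f j)"] by (metis not_le)
    obtain i where i: "i \<in> J"
      and S0: "real (card S) \<le> card J * real (card {f \<in> S. \<forall>j\<in>J. s (f i) \<le> s (f j)})"
      using dense_color[OF J(1) Jne finS, of "\<lambda>i f. \<forall>j\<in>J. s (f i) \<le> s (f j)"] least by blast
    have "\<alpha> * (\<Prod>j\<in>J. real (card (I j))) \<le> real (m + 2) * real (card {f \<in> S. \<forall>j\<in>J. s (f i) \<le> s (f j)})"
      using order_trans[OF dense[folded S_def] S0] J(2) by simp
    then have S1: "\<alpha>1 * (\<Prod>j\<in>J. real (card (I j))) \<le> real (card {f \<in> S. \<forall>j\<in>J. s (f i) \<le> s (f j)})"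
      by (simp add: \<alpha>1_def divide_le_eq mult.commute)
    define J' where "J' = J - {i}"
    have J': "finite J'" "card J' = Suc m" "J' \<subseteq> J"
      using J i by (auto simp: J'_def)
    then have J'_ne: "J' \<noteq> {}" by auto
    \<comment> \<open>Averaging fixes the smallest cone \<open>D a\<close>. In the remaining
      selections all other cones have size at least \<open>s a\<close>, as thickening and perturbing
      at that scale require.\<close>
    obtain a where a: "a \<in> I i" and slice: "\<alpha>1 * (\<Prod>j\<in>J'. real (card (I j))) \<le>
        real (card {g \<in> PiE J' I. g(i := a) \<in> {f \<in> S. \<forall>j\<in>J. s (f i) \<le> s (f j)}})"
      using dense_slice[OF J(1) _ i _ _ S1] I i unfolding J'_def S_def by blast
    define H where "H = {g \<in> PiE J' I. g(i := a) \<in> {f \<in> S. \<forall>j\<in>J. s (f i) \<le> s (f j)}}"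
    define \<delta> where "\<delta> = s a"
    have fat_a: "fat_cone c W \<delta> (D a)" using I i a by (auto simp: \<delta>_def)
    have \<delta>: "0 < \<delta>" using fat_coneD(4)[OF fat_a] .
    obtain x where x: "x \<in> D a" "norm x = 1" using fat_cone_unit[OF fat_a] .
    have xW: "x \<in> W" using x(1) fat_coneD(1)[OF fat_a] by blast
    \<comment> \<open>These cones come too close to the line through \<open>x\<close> and violate
      assumption \<open>far\<close> of \<open>fat_cone_project\<close>.\<close>
    define B where "B = (\<lambda>j. {b \<in> I j. \<delta> \<le> s b \<and> (\<exists>u\<in>D b. norm (perp x u) \<le> 8 * \<delta> * norm u)})"
    show "\<exists>j\<in>J. \<exists>G\<subseteq>I j. \<beta> * real (card (I j)) \<le> real (card G) \<and> cone_transversal (Suc m) (D ` G)"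
    proof (cases "\<exists>j\<in>J'. \<tau> * real (card (I j)) \<le> real (card (B j))")
      \<comment> \<open>Here the line through \<open>x\<close> itself is the subspace to be
        perturbed; its dimension \<open>1\<close> is at most \<open>Suc m\<close>.\<close>
      case True
      then obtain j where j: "j \<in> J'" "\<tau> * real (card (I j)) \<le> real (card (B j))" by blast
      have jJ: "j \<in> J" using j J' by blast
      have finB: "finite (B j)" using I jJ by (simp add: B_def)
      have "\<forall>b\<in>B j. fat_cone c W (s b) (D b) \<and> \<delta> \<le> s b \<and>
          (\<exists>p\<in>span {x} \<inter> W. \<exists>u\<in>D b. norm u = 1 \<and> 1 / 2 \<le> norm p \<and> norm (p - u) \<le> 16 * \<delta>)"
      proof
        fix b assume "b \<in> B j"
        then obtain u where b: "b \<in> I j" "\<delta> \<le> s b" "u \<in> D b" "norm (perp x u) \<le> 8 * \<delta> * norm u"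
          by (auto simp: B_def)
        have fb: "fat_cone c W (s b) (D b)" using I jJ b(1) by blast
        show "fat_cone c W (s b) (D b) \<and> \<delta> \<le> s b \<and>
          (\<exists>p\<in>span {x} \<inter> W. \<exists>u\<in>D b. norm u = 1 \<and> 1 / 2 \<le> norm p \<and> norm (p - u) \<le> 16 * \<delta>)"
          using fb b(2) transversal_pole[OF fb W xW x(2) b(3,4)] by blast
      qed
      from shift[THEN spec, THEN spec, THEN spec, THEN spec, THEN spec, THEN spec,
          THEN mp, OF finB, THEN mp, OF W, THEN mp, OF subspace_span, THEN mp, OF \<delta>, THEN mp, OF this]
      obtain G V where G: "G \<subseteq> B j" "\<beta>1 * real (card (B j)) \<le> real (card G)"
        and V: "subspace V" "dim V \<le> dim (span {x})" "\<forall>b\<in>G. V \<inter> D b \<noteq> {}"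
        by (elim exE conjE) (rule that)
      have "dim (span {x}) \<le> card {x}" by (simp only: dim_span) (rule dim_le_card', simp)
      then have "cone_transversal (Suc m) (D ` G)"
        unfolding cone_transversal_def using V by (intro exI[of _ V]) auto
      moreover have "\<beta> * real (card (I j)) \<le> real (card G)"
      proof -
        have "\<beta> * real (card (I j)) \<le> \<beta>1 * \<tau> * real (card (I j))"
          by (intro mult_right_mono) (auto simp: \<beta>_def)
        also have "\<dots> \<le> \<beta>1 * real (card (B j))" using j(2) \<beta>1 by (simp add: mult.assoc)
        finally show ?thesis using G(2) by simp
      qed
      moreover have "G \<subseteq> I j" using G(1) by (auto simp: B_def)
      ultimately show ?thesis using jJ by blast
    next
      case False
      define I' where "I' = (\<lambda>j. {b \<in> I j. \<delta> \<le> s b \<and> b \<notin> B j})"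
      define H' where "H' = {f \<in> H. \<forall>j\<in>J'. f j \<notin> B j}"
      have finI: "finite (I j)" if "j \<in> J'" for j using I J' that by blast
      have sparse: "B j \<subseteq> I j \<and> real (card (B j)) \<le> \<alpha>1 / (2 * card J') * real (card (I j))" if "j \<in> J'" for j
        using False that J'(2) by (auto simp: B_def \<tau>_def)
      have HP: "H \<subseteq> PiE J' I" by (auto simp: H_def)
      have H': "\<alpha>1 / 2 * (\<Prod>j\<in>J'. real (card (I j))) \<le> real (card H')"
        unfolding H'_def by (rule dense_avoid[OF J'(1) finI J'_ne HP slice[folded H_def] sparse])
      have H'I': "H' \<subseteq> PiE J' I'"
      proof
        fix f assume f: "f \<in> H'"
        then have fP: "f \<in> PiE J' I" and le: "\<And>j. j \<in> J \<Longrightarrow> s ((f(i := a)) i) \<le> s ((f(i := a)) j)"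
          by (auto simp: H'_def H_def)
        have "f j \<in> I' j" if j: "j \<in> J'" for j
        proof -
          have "f j \<in> I j" using fP j by (rule PiE_mem)
          moreover have "\<delta> \<le> s (f j)" using le[of j] j by (auto simp: J'_def \<delta>_def)
          moreover have "f j \<notin> B j" using f j by (simp add: H'_def)
          ultimately show ?thesis by (simp add: I'_def)
        qed
        then show "f \<in> PiE J' I'" using fP by (simp add: PiE_iff)
      qed
      \<comment> \<open>A dense set of selections confined to \<open>I'\<close> forces each
        \<open>I' j\<close> to be a positive fraction of \<open>I j\<close>. This converts the
        fraction of \<open>I' j\<close> found by induction into one of \<open>I j\<close>.\<close>
      have I'_large: "\<alpha>1 / 2 * real (card (I j)) \<le> real (card (I' j))" if j: "j \<in> J'" for j
      proof -
        define Q where "Q = (\<Prod>l\<in>J' - {j}. real (card (I l)))"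
        have Q: "0 < Q" unfolding Q_def using I J' by (intro prod_pos) (auto simp: card_gt_0_iff)
        have "H' \<subseteq> {f \<in> PiE J' I. f j \<in> I' j}" using H'I' j by (auto simp: H'_def H_def)
        then have "card H' \<le> card {f \<in> PiE J' I. f j \<in> I' j}"
          using J'(1) finI by (intro card_mono) (simp_all add: finite_PiE)
        also have "\<dots> = card (I' j) * (\<Prod>l\<in>J' - {j}. card (I l))"
          by (rule card_PiE_slice) (use J'(1) finI j in \<open>auto simp: I'_def\<close>)
        finally have "real (card H') \<le> real (card (I' j)) * Q"
          unfolding Q_def of_nat_prod[symmetric] of_nat_mult[symmetric] by (rule of_nat_mono)
        then have "(\<alpha>1 / 2 * real (card (I j))) * Q \<le> real (card (I' j)) * Q"
          using H' J'(1) j by (simp add: Q_def prod.remove)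
        then show ?thesis using Q by simp
      qed
      have I'_ne: "finite (I' j) \<and> I' j \<noteq> {}" if j: "j \<in> J'" for j
      proof -
        have "0 < \<alpha>1 / 2 * real (card (I j))" using pos I J' j by (auto simp: card_gt_0_iff)
        then have "0 < card (I' j)" using I'_large[OF j] by linarith
        then show ?thesis by (simp add: card_gt_0_iff)
      qed
      have I'D: "fat_cone c W (s b) (D b)" "\<delta> \<le> s b" "\<And>u. u \<in> D b \<Longrightarrow> 8 * \<delta> * norm u < norm (perp x u)"
        if "j \<in> J'" "b \<in> I' j" for j b
        using that I J'(3) by (auto simp: I'_def B_def not_le)
      obtain j0 b0 where jb: "j0 \<in> J'" "b0 \<in> I' j0" using J'_ne I'_ne by blast
      obtain u0 where "u0 \<in> D b0" "norm u0 = 1" using fat_cone_unit[OF I'D(1)[OF jb]] .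
      \<comment> \<open>The projection of a unit vector has norm at most \<open>1\<close>, while
        \<open>8 * \<delta>\<close> is smaller than that norm in a surviving cone. The bounds
        \<open>1 / 2\<close> and \<open>1 / 4\<close> wanted for projecting and lifting
        follow.\<close>
      then have \<delta>_small: "\<delta> < 1 / 8" using I'D(3)[OF jb, of u0] norm_perp_le[OF x(2), of u0] by simp
      define W' where "W' = {w \<in> W. w \<bullet> x = 0}"
      have W': "subspace W'" using W by (auto simp: W'_def subspace_def inner_simps)
      define D' where "D' = (\<lambda>b. perp x ` cone_nbhd W \<delta> (D b))"
      have fat': "\<exists>s'. fat_cone (c / 60) W' s' (D' b)" if "j \<in> J'" "b \<in> I' j" for j b
        using fat_cone_project[OF I'D(1)[OF that] Suc.prems(1,2) W xW x(2) \<delta> I'D(2)[OF that]] I'D(3)[OF that]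
        by (simp add: W'_def D'_def)
      define s' where "s' = (\<lambda>b. SOME s'. fat_cone (c / 60) W' s' (D' b))"
      have s': "fat_cone (c / 60) W' (s' b) (D' b)" if "j \<in> J'" "b \<in> I' j" for j b
        unfolding s'_def by (rule someI_ex) (rule fat'[OF that])
      have "H' \<subseteq> {f \<in> PiE J' I'. cone_transversal m (D' ` f ` J')}"
      proof
        fix f assume f: "f \<in> H'"
        have fP: "f \<in> PiE J' I'" using f H'I' by blast
        have "cone_transversal (Suc m) (D ` (f(i := a)) ` J)" using f by (simp add: H'_def H_def S_def)
        moreover have "(f(i := a)) ` J = insert a (f ` J')" using i by (auto simp: J'_def)
        ultimately have "cone_transversal (Suc m) (insert (D a) (D ` f ` J'))" by simp
        moreover have "K \<subseteq> W" if "K \<in> D ` f ` J'" for K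
          using that fP fat_coneD(1)[OF I'D(1)] by (fastforce dest: PiE_mem)
        ultimately have "cone_transversal m ((\<lambda>K. perp x ` cone_nbhd W \<delta> K) ` D ` f ` J')"
          using transversal_project[OF fat_a _ x W, of "D ` f ` J'" m] \<delta>_small by simp
        then show "f \<in> {f \<in> PiE J' I'. cone_transversal m (D' ` f ` J')}"
          using fP by (simp add: D'_def image_image)
      qed
      then have "card H' \<le> card {f \<in> PiE J' I'. cone_transversal m (D' ` f ` J')}"
        using J'(1) I'_ne by (intro card_mono) (simp_all add: finite_PiE)
      \<comment> \<open>Shrinking the families only decreases the product, so density
        \<open>\<alpha>1 / 2\<close> carries over to \<open>I'\<close>.\<close>
      moreover have "(\<Prod>j\<in>J'. real (card (I' j))) \<le> (\<Prod>j\<in>J'. real (card (I j)))"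
        using finI by (intro prod_mono) (auto simp: I'_def intro: card_mono)
      then have "\<alpha>1 / 2 * (\<Prod>j\<in>J'. real (card (I' j))) \<le> \<alpha>1 / 2 * (\<Prod>j\<in>J'. real (card (I j)))"
        using pos by (intro mult_left_mono) auto
      ultimately have dense': "\<alpha>1 / 2 * (\<Prod>j\<in>J'. real (card (I' j)))
          \<le> real (card {f \<in> PiE J' I'. cone_transversal m (D' ` f ` J')})" using H' by linarith
      have fam: "\<forall>j\<in>J'. finite (I' j) \<and> I' j \<noteq> {} \<and> (\<forall>b\<in>I' j. fat_cone (c / 60) W' (s' b) (D' b))"
        using I'_ne s' by blast
      from IH[THEN spec, THEN spec, THEN spec, THEN spec, THEN spec, THEN mp, OF W', THEN mp, OF J'(1),
          THEN mp, OF J'(2), THEN mp, OF fam, THEN mp, OF dense']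
      obtain j G where j: "j \<in> J'" and G: "G \<subseteq> I' j" "\<beta>2 * real (card (I' j)) \<le> real (card G)"
        and trG: "cone_transversal m (D' ` G)" by (elim bexE exE conjE) (rule that)
      obtain V where V: "subspace V" "dim V \<le> m" "\<forall>K\<in>D' ` G. V \<inter> K \<noteq> {}"
        using trG by (elim cone_transversalE)
      have jJ: "j \<in> J" using j J' by blast
      have finG: "finite G" using G(1) I'_ne[OF j] finite_subset by blast
      have "\<forall>b\<in>G. fat_cone c W (s b) (D b) \<and> \<delta> \<le> s b \<and>
          (\<exists>p\<in>span (insert x V) \<inter> W. \<exists>u\<in>D b. norm u = 1 \<and> 1 / 2 \<le> norm p \<and> norm (p - u) \<le> 16 * \<delta>)"
      proof
        fix b assume b: "b \<in> G"
        then have bI: "b \<in> I' j" using G(1) by blast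
        obtain w where w: "w \<in> V" "w \<in> perp x ` cone_nbhd W \<delta> (D b)"
          using V(3) b unfolding D'_def by blast
        have "\<delta> \<le> 1 / 4" using \<delta>_small by simp
        from transversal_lift[OF I'D(1)[OF j bI] W xW \<delta> this w] I'D(1,2)[OF j bI]
        show "fat_cone c W (s b) (D b) \<and> \<delta> \<le> s b \<and>
          (\<exists>p\<in>span (insert x V) \<inter> W. \<exists>u\<in>D b. norm u = 1 \<and> 1 / 2 \<le> norm p \<and> norm (p - u) \<le> 16 * \<delta>)"
          by blast
      qed
      from shift[THEN spec, THEN spec, THEN spec, THEN spec, THEN spec, THEN spec,
          THEN mp, OF finG, THEN mp, OF W, THEN mp, OF subspace_span, THEN mp, OF \<delta>, THEN mp, OF this]
      obtain G' V' where G': "G' \<subseteq> G" "\<beta>1 * real (card G) \<le> real (card G')"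
        and V': "subspace V'" "dim V' \<le> dim (span (insert x V))" "\<forall>b\<in>G'. V' \<inter> D b \<noteq> {}"
        by (elim exE conjE) (rule that)
      have "dim (span (insert x V)) \<le> Suc m" using V(2) by (simp add: dim_span dim_insert)
      then have "cone_transversal (Suc m) (D ` G')"
        unfolding cone_transversal_def using V' by (intro exI[of _ V']) auto
      moreover have "\<beta> * real (card (I j)) \<le> real (card G')"
      proof -
        have "\<beta> * real (card (I j)) \<le> \<beta>1 * (\<beta>2 * (\<alpha>1 / 2)) * real (card (I j))"
          by (intro mult_right_mono) (auto simp: \<beta>_def)
        also have "\<dots> = \<beta>1 * (\<beta>2 * (\<alpha>1 / 2 * real (card (I j))))" by simp
        also have "\<dots> \<le> \<beta>1 * (\<beta>2 * real (card (I' j)))"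
          using I'_large[OF j] \<beta>1 \<beta>2 by (intro mult_left_mono) auto
        also have "\<dots> \<le> \<beta>1 * real (card G)" using G(2) \<beta>1 by (intro mult_left_mono) auto
        finally show ?thesis using G'(2) by simp
      qed
      moreover have "G' \<subseteq> I j" using G'(1) G(1) by (auto simp: I'_def)
      ultimately show ?thesis using jJ by blast
    qed
  qed
qed

section \<open>Spherically convex sets\<close>

lemma norm_diff_cap_le:
  assumes x: "norm x = 1" and u: "u \<in> cap x R"
  shows "norm (x - u) \<le> R"
proof -
  have un: "norm u = 1" and ang: "arccos (x \<bullet> u) \<le> R" using u by (auto simp: cap_def sph_angle_def)
  define t where "t = arccos (x \<bullet> u)"
  have b: "\<bar>x \<bullet> u\<bar> \<le> 1" using Cauchy_Schwarz_ineq2[of x u] x un by simp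
  then have t: "0 \<le> t" "cos t = x \<bullet> u" using arccos_lbound[of "x \<bullet> u"] by (auto simp: t_def abs_le_iff cos_arccos_abs)
  \<comment> \<open>The chord of an arc \<open>t\<close> has length \<open>2 * sin (t / 2)\<close>,
    at most \<open>t\<close>.\<close>
  have "(norm (x - u))\<^sup>2 = 2 - 2 * cos t"
    using x un t(2) by (simp add: power2_norm_eq_inner inner_simps inner_commute norm_eq_1)
  also have "\<dots> = (2 * sin (t / 2))\<^sup>2"
    using cos_double_sin[of "t / 2"] by (simp add: power_mult_distrib)
  also have "\<dots> \<le> t\<^sup>2"
    using abs_sin_x_le_abs_x[of "t / 2"] by (subst abs_le_square_iff[symmetric]) (simp add: abs_mult)
  finally have "norm (x - u) \<le> t" using t(1) by (rule power2_le_imp_le)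
  then show ?thesis using ang by (simp add: t_def)
qed

text \<open>For \<open>r \<le> 1\<close> the Taylor expansion gives
  \<open>cos r \<le> 1 - 11 / 24 * r ^ 2\<close>, below \<open>1 - 2 / 9 * r ^ 2\<close>, the inner
  product belonging to a chord of length \<open>2 / 3 * r\<close>.\<close>

lemma mem_cap_of_norm_diff:
  assumes x: "norm x = 1" and u: "norm u = 1" and r: "0 < r" "r \<le> 1" and d: "norm (x - u) \<le> 2 / 3 * r"
  shows "u \<in> cap x r"
proof -
  have b: "\<bar>x \<bullet> u\<bar> \<le> 1" using Cauchy_Schwarz_ineq2[of x u] x u by simp
  obtain t where t: "cos r = (\<Sum>m<4. cos_coeff m * r ^ m) + (cos (t + 1/2 * real 4 * pi) / fact 4) * r ^ 4"
    using Maclaurin_cos_expansion2[OF r(1), of 4] by auto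
  have r4: "r ^ 4 \<le> r\<^sup>2" using r by (intro power_decreasing) auto
  have "(cos (t + 1/2 * real 4 * pi) / fact 4) * r ^ 4 \<le> 1 / 24 * r ^ 4"
    using r by (intro mult_right_mono) (auto simp: fact_numeral)
  moreover have "(\<Sum>m<4. cos_coeff m * r ^ m) = 1 - r\<^sup>2 / 2"
    by (simp add: cos_coeff_def lessThan_nat_numeral lessThan_Suc)
  ultimately have "cos r \<le> 1 - 2 / 9 * r\<^sup>2" using t r4 zero_le_power2[of r] by linarith
  also have "\<dots> \<le> x \<bullet> u"
  proof -
    have "(norm (x - u))\<^sup>2 \<le> (2 / 3 * r)\<^sup>2" using d by (intro power_mono) auto
    moreover have "(norm (x - u))\<^sup>2 = 2 - 2 * (x \<bullet> u)"
      using x u by (simp add: power2_norm_eq_inner inner_simps inner_commute norm_eq_1)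
    ultimately show ?thesis by (simp add: power_mult_distrib power2_eq_square)
  qed
  finally have "arccos (x \<bullet> u) \<le> arccos (cos r)" using b by (intro arccos_le_arccos) auto
  also have "\<dots> = r" using r pi_gt3 by (intro arccos_cos) auto
  finally show ?thesis using u by (simp add: cap_def sph_angle_def)
qed

text \<open>Normalising moves \<open>z\<close> by the gap between \<open>norm z\<close> and
  \<open>1\<close>, at most \<open>norm (z - x)\<close>. Two displacements of at most
  \<open>r / 3\<close> stay within the chord \<open>2 / 3 * r\<close>.\<close>

lemma mem_cap_sgn:
  assumes x: "norm x = 1" and r: "0 < r" "r \<le> 1" and z: "norm (z - x) \<le> r / 3"
  shows "z \<noteq> 0" "sgn z \<in> cap x r"
proof -
  show z0: "z \<noteq> 0" using z x r by auto
  have "sgn z - z = (1 - norm z) *\<^sub>R sgn z" using z0 by (simp add: sgn_div_norm algebra_simps)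
  then have "norm (sgn z - z) = \<bar>1 - norm z\<bar>" using z0 by (simp add: norm_sgn)
  also have "\<dots> \<le> norm (z - x)" using norm_triangle_ineq3[of z x] x by (simp add: abs_minus_commute)
  finally have "norm (x - sgn z) \<le> 2 / 3 * r"
    using norm_triangle_ineq[of "x - z" "z - sgn z"] z by (simp add: norm_minus_commute)
  then show "sgn z \<in> cap x r" using x z0 r by (intro mem_cap_of_norm_diff) (auto simp: norm_sgn)
qed

section \<open>Fatness of the double cone over a convex set\<close>

definition double_cone :: "'a::euclidean_space set \<Rightarrow> 'a set" where
  "double_cone K = {t *\<^sub>R u | t u. t \<noteq> 0 \<and> u \<in> K}"

text \<open>Up to a positive factor the combination is a point of the chord from \<open>u\<close> to
  \<open>v\<close>, whose normalisation lies on the short arc.\<close>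

lemma sph_convex_cone:
  assumes K: "K \<subseteq> unit_sphere" "\<And>x y. x \<in> K \<Longrightarrow> y \<in> K \<Longrightarrow> short_arc x y \<subseteq> K"
    and uv: "u \<in> K" "v \<in> K" "0 \<le> a" "0 \<le> b" "0 < a + b"
  shows "a *\<^sub>R u + b *\<^sub>R v \<in> double_cone K"
proof -
  define q where "q = (a / (a + b)) *\<^sub>R u + (b / (a + b)) *\<^sub>R v"
  have ab: "a / (a + b) = 1 - b / (a + b)" "0 \<le> b / (a + b)" "b / (a + b) \<le> 1"
    using uv by (auto simp: field_simps)
  then have "q \<in> closed_segment u v" unfolding q_def in_segment by (intro exI[of _ "b / (a + b)"]) auto
  then have q: "sgn q \<in> K" using K(2)[OF uv(1,2)] by (auto simp: short_arc_def)
  \<comment> \<open>Since \<open>sgn 0 = 0\<close> lies off the sphere, the chord avoids the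
    origin.\<close>
  then have "norm (sgn q) = 1" using K(1) by auto
  then have q0: "q \<noteq> 0" by (auto simp: norm_sgn split: if_splits)
  have "a *\<^sub>R u + b *\<^sub>R v = (a + b) *\<^sub>R q" using uv(5) by (simp add: q_def scaleR_add_right)
  also have "\<dots> = ((a + b) * norm q) *\<^sub>R sgn q" using q0 by (simp add: sgn_div_norm)
  finally show ?thesis using q q0 uv(5) unfolding double_cone_def by (metis (mono_tags, lifting) mem_Collect_eq less_numeral_extra(3) mult_eq_0_iff norm_eq_zero)
qed

text \<open>Unless \<open>K\<close> is the whole sphere, its positive hull is convex and contains a
  ball of radius \<open>r' / 3\<close> about \<open>x\<close>. Contracting this ball towards a point
  of \<open>K\<close> by the ratio \<open>\<epsilon> / (2 * s)\<close> yields the interior balls; as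
  \<open>s \<le> 2 * \<rho> * r'\<close>, their radius is at least
  \<open>\<epsilon> / (12 * \<rho>)\<close>.\<close>

lemma fat_cone_double_cone:
  fixes K :: "'a::euclidean_space set"
  assumes K: "sph_convex K" and \<rho>: "1 \<le> \<rho>" and x: "x \<in> unit_sphere"
    and r: "0 < r" "r \<le> R" "R \<le> \<rho> * r" "cap x r \<subseteq> K" "K \<subseteq> cap x R"
  shows "\<exists>s. fat_cone (1 / (12 * \<rho>)) UNIV s (double_cone K)"
proof -
  have Ksph: "K \<subseteq> unit_sphere" using K by (simp add: sph_convex_def)
  have xn: "norm x = 1" using x by simp
  have xK: "x \<in> K" using r xn by (auto simp: cap_def sph_angle_def norm_eq_1)
  have zero: "0 \<notin> double_cone K" using Ksph by (auto simp: double_cone_def)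
  have ne: "double_cone K \<noteq> {}" using xK by (auto simp: double_cone_def intro!: exI[of _ "1::real"])
  have sc: "t *\<^sub>R p \<in> double_cone K" if pt: "p \<in> double_cone K" "t \<noteq> 0" for p t
  proof -
    obtain t' u where "t' \<noteq> 0" "u \<in> K" "p = t' *\<^sub>R u" using pt(1) by (auto simp: double_cone_def)
    then have "t * t' \<noteq> 0 \<and> u \<in> K \<and> t *\<^sub>R p = (t * t') *\<^sub>R u" using pt(2) by simp
    then show ?thesis unfolding double_cone_def by blast
  qed
  show ?thesis
  proof (cases "K = unit_sphere")
    case True
    \<comment> \<open>The cone is everything except the origin, so size \<open>1\<close> and balls
      centred at the points themselves suffice.\<close>
    have all: "p \<in> double_cone K" if "p \<noteq> 0" for p
    proof -
      have "norm p \<noteq> 0 \<and> sgn p \<in> K \<and> p = norm p *\<^sub>R sgn p" using that True by (simp add: norm_sgn sgn_div_norm)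
      then show ?thesis unfolding double_cone_def by blast
    qed
    have "fat_cone (1 / (12 * \<rho>)) UNIV 1 (double_cone K)"
      unfolding fat_cone_def
    proof (intro conjI ballI allI impI)
      fix p q :: 'a
      show "\<exists>t. norm (t *\<^sub>R p - q) \<le> 1 * norm q" by (intro exI[of _ 0]) simp
    next
      fix p and \<epsilon> :: real assume p: "p \<in> double_cone K" and e: "0 < \<epsilon> \<and> \<epsilon> \<le> 1"
      have p0: "p \<noteq> 0" using p zero by blast
      have "z \<in> double_cone K" if "norm (z - p) \<le> 1 / (12 * \<rho>) * \<epsilon> * norm p" for z
      proof -
        have "1 / (12 * \<rho>) * \<epsilon> \<le> 1 / 12 * 1" using \<rho> e by (intro mult_mono) (auto simp: field_simps)
        then have "1 / (12 * \<rho>) * \<epsilon> * norm p \<le> 1 / 12 * norm p" by (intro mult_right_mono) auto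
        moreover have "0 < norm p" using p0 by simp
        ultimately have "norm (z - p) < norm p" using that by linarith
        then have "z \<noteq> 0" by auto
        then show ?thesis by (rule all)
      qed
      then show "\<exists>y\<in>UNIV. norm (y - p) \<le> \<epsilon> * norm p \<and>
          (\<forall>z\<in>UNIV. norm (z - y) \<le> 1 / (12 * \<rho>) * \<epsilon> * norm p \<longrightarrow> z \<in> double_cone K)"
        using e by (intro bexI[of _ p]) auto
    qed (use zero ne sc in auto)
    then show ?thesis by blast
  next
    case False
    then have arc: "short_arc y z \<subseteq> K" if "y \<in> K" "z \<in> K" for y z
      using K that by (simp add: sph_convex_def)
    \<comment> \<open>\<open>mem_cap_sgn\<close> is available for radii up to \<open>1\<close>
      only.\<close>
    define r' where "r' = min r 1"
    have r': "0 < r'" "r' \<le> 1" "cap x r' \<subseteq> K" using r by (auto simp: r'_def cap_def)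
    \<comment> \<open>Two points of \<open>K\<close> are at most \<open>2 * R\<close> apart,
      measured through \<open>x\<close>; at size \<open>1\<close> the diameter condition is
      void.\<close>
    define s where "s = min 1 (2 * R)"
    have s: "0 < s" "s \<le> 1" using r by (auto simp: s_def)
    have s_le: "s \<le> 2 * \<rho> * r'"
    proof (cases "r \<le> 1")
      case True
      then show ?thesis using r by (simp add: s_def r'_def min_def)
    next
      case False
      then show ?thesis using \<rho> by (simp add: s_def r'_def min_def)
    qed
    have near: "norm (x - u) \<le> min R 2" if u: "u \<in> K" for u
    proof -
      have "norm u = 1" using Ksph u by auto
      then have "norm (x - u) \<le> 2" using norm_triangle_ineq4[of x u] xn by simp
      then show ?thesis using norm_diff_cap_le[OF xn] r(5) u by auto
    qed
    have "fat_cone (1 / (12 * \<rho>)) UNIV s (double_cone K)"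
      unfolding fat_cone_def
    proof (intro conjI ballI allI impI)
      fix p q assume p: "p \<in> double_cone K" and q: "q \<in> double_cone K"
      show "\<exists>t. norm (t *\<^sub>R p - q) \<le> s * norm q"
      proof (cases "2 * R \<ge> 1")
        case True
        then show ?thesis by (intro exI[of _ 0]) (simp add: s_def)
      next
        case False
        obtain t1 u1 where 1: "t1 \<noteq> 0" "u1 \<in> K" "p = t1 *\<^sub>R u1" using p by (auto simp: double_cone_def)
        obtain t2 u2 where 2: "t2 \<noteq> 0" "u2 \<in> K" "q = t2 *\<^sub>R u2" using q by (auto simp: double_cone_def)
        have n2: "norm u2 = 1" using Ksph 2(2) by auto
        have "norm (u1 - u2) \<le> 2 * R"
          using norm_triangle_ineq[of "u1 - x" "x - u2"] near[OF 1(2)] near[OF 2(2)] by (simp add: norm_minus_commute)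
        then have "\<bar>t2\<bar> * norm (u1 - u2) \<le> \<bar>t2\<bar> * s" using False by (intro mult_left_mono) (auto simp: s_def)
        moreover have "(t2 / t1) *\<^sub>R p - q = t2 *\<^sub>R (u1 - u2)" using 1 2 by (simp add: scaleR_diff_right)
        ultimately have "norm ((t2 / t1) *\<^sub>R p - q) \<le> s * norm q" using 2 n2 by (simp add: mult.commute)
        then show ?thesis by blast
      qed
    next
      fix p \<epsilon> assume p: "p \<in> double_cone K" and "0 < \<epsilon> \<and> \<epsilon> \<le> s"
      then have e: "0 < \<epsilon>" "\<epsilon> \<le> s" by auto
      obtain t u where t: "t \<noteq> 0" "u \<in> K" "p = t *\<^sub>R u" using p by (auto simp: double_cone_def)
      have un: "norm u = 1" using Ksph t(2) by auto
      define l where "l = \<epsilon> / (2 * s)"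
      have l: "0 < l" "l \<le> 1 / 2" "l * (2 * s) = \<epsilon>" using e s by (auto simp: l_def field_simps)
      define y where "y = (1 - l) *\<^sub>R u + l *\<^sub>R x"
      show "\<exists>y\<in>UNIV. norm (y - p) \<le> \<epsilon> * norm p \<and>
          (\<forall>z\<in>UNIV. norm (z - y) \<le> 1 / (12 * \<rho>) * \<epsilon> * norm p \<longrightarrow> z \<in> double_cone K)"
      proof (intro bexI[of _ "t *\<^sub>R y"] conjI ballI impI)
        have "norm (x - u) \<le> 2 * s" using near[OF t(2)] r by (auto simp: s_def min_def split: if_splits)
        then have "l * norm (x - u) \<le> \<epsilon>" using l mult_left_mono[of "norm (x - u)" "2 * s" l] by simp
        moreover have "t *\<^sub>R y - p = (t * l) *\<^sub>R (x - u)" by (simp add: y_def t(3) algebra_simps)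
        ultimately show "norm (t *\<^sub>R y - p) \<le> \<epsilon> * norm p"
          using mult_left_mono[of "l * norm (x - u)" \<epsilon> "\<bar>t\<bar>"] l un by (simp add: t(3) abs_mult mult_ac)
        fix z assume z: "norm (z - t *\<^sub>R y) \<le> 1 / (12 * \<rho>) * \<epsilon> * norm p"
        \<comment> \<open>The preimage of \<open>z\<close> divided by \<open>t\<close> under the
          contraction with centre \<open>u\<close> and ratio \<open>l\<close>, which takes
          \<open>x\<close> to \<open>y\<close>. If \<open>z\<close> is close to
          \<open>t *\<^sub>R y\<close>, then \<open>x'\<close> is close to \<open>x\<close>.\<close>
        define x' where "x' = x + (1 / l) *\<^sub>R ((1 / t) *\<^sub>R z - y)"
        have "norm (x' - x) = norm (z - t *\<^sub>R y) / (l * \<bar>t\<bar>)"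
        proof -
          have "x' - x = (1 / (l * t)) *\<^sub>R (z - t *\<^sub>R y)" using t(1) l by (simp add: x'_def algebra_simps)
          then show ?thesis using l by (simp add: abs_mult)
        qed
        also have "\<dots> \<le> (1 / (12 * \<rho>) * \<epsilon> * norm p) / (l * \<bar>t\<bar>)"
          using z l by (intro divide_right_mono) auto
        also have "\<dots> = 1 / (12 * \<rho>) * (2 * s)" 
          using t(1) l(1) un by (simp add: t(3) l(3)[symmetric])
        also have "\<dots> \<le> 1 / (12 * \<rho>) * (2 * (2 * \<rho> * r'))"
          using s_le \<rho> by (intro mult_left_mono) auto
        also have "\<dots> = r' / 3" using \<rho> by simp
        finally have x': "x' \<noteq> 0" "sgn x' \<in> K"
          using mem_cap_sgn[OF xn r'(1,2), of x'] r'(3) by auto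
        have "(1 / t) *\<^sub>R z = (1 - l) *\<^sub>R u + (l * norm x') *\<^sub>R sgn x'"
        proof -
          have "(l * norm x') *\<^sub>R sgn x' = l *\<^sub>R x'" using x' by (simp add: sgn_div_norm)
          also have "\<dots> = l *\<^sub>R x + ((1 / t) *\<^sub>R z - y)" using l by (simp add: x'_def scaleR_add_right)
          finally show ?thesis by (simp add: y_def)
        qed
        also have "\<dots> \<in> double_cone K"
        proof (rule sph_convex_cone[OF Ksph arc t(2) x'(2)])
          have "0 \<le> l * norm x'" using l by simp
          then show "0 < 1 - l + l * norm x'" "0 \<le> l * norm x'" using l by linarith+
        qed (use l in auto)
        finally have "t *\<^sub>R ((1 / t) *\<^sub>R z) \<in> double_cone K" using t(1) by (rule sc)
        then show "z \<in> double_cone K" using t(1) by simp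
      qed simp
    qed (use zero ne sc s in auto)
    then show ?thesis by blast
  qed
qed

section \<open>From great spheres to linear subspaces\<close>

lemma subspace_meets_double_cone:
  assumes "subspace V"
  shows "V \<inter> double_cone K \<noteq> {} \<longleftrightarrow> V \<inter> K \<noteq> {}"
proof
  assume "V \<inter> double_cone K \<noteq> {}"
  then obtain t u where tu: "t \<noteq> 0" "u \<in> K" "t *\<^sub>R u \<in> V" by (auto simp: double_cone_def)
  then have "(1 / t) *\<^sub>R (t *\<^sub>R u) \<in> V" using assms subspace_scale by blast
  then show "V \<inter> K \<noteq> {}" using tu by auto
next
  assume "V \<inter> K \<noteq> {}"
  then obtain u where "u \<in> V" "u \<in> K" by blast
  moreover have "u \<in> double_cone K"
    unfolding double_cone_def using \<open>u \<in> K\<close> by (auto intro!: exI[of _ "1::real"] exI[of _ u])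
  ultimately show "V \<inter> double_cone K \<noteq> {}" by auto
qed

lemma subspace_extend_dim:
  fixes V :: "'a::euclidean_space set"
  assumes "subspace V" "dim V \<le> m" "m \<le> DIM('a)"
  shows "\<exists>U. subspace U \<and> dim U = m \<and> V \<subseteq> U"
proof -
  obtain B where B: "B \<subseteq> V" "independent B" "V \<subseteq> span B" "card B = dim V" using basis_exists[of V] by blast
  obtain C where C: "B \<subseteq> C" "independent C" "UNIV \<subseteq> span C"
    by (rule maximal_independent_subset_extend[OF subset_UNIV B(2)])
  have "card C = DIM('a)" using dim_unique[OF subset_UNIV C(3,2) refl] by (simp add: dim_UNIV)
  then obtain E where E: "B \<subseteq> E" "E \<subseteq> C" "card E = m"
    using exists_subset_between[of B m C] B(4) C(1) assms independent_imp_finite[OF C(2)] by auto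
  have "dim (span E) = m" 
    using dim_eq_card_independent[OF independent_mono[OF C(2) E(2)]] E(3) by (simp only: dim_span)
  moreover have "V \<subseteq> span E" using B(3) span_mono[OF E(1)] by blast
  ultimately show ?thesis using subspace_span by blast
qed

text \<open>Double cones and their spherical sets meet the same subspaces. A subspace of too small
  dimension can be enlarged to dimension exactly \<open>k + 1\<close>, which is where
  \<open>k + 1 \<le> DIM('a)\<close> enters.\<close>

lemma has_sph_transversal_iff_cone_transversal:
  fixes \<F> :: "'a::euclidean_space set set"
  assumes k: "k + 1 \<le> DIM('a)" and sph: "\<And>K. K \<in> \<F> \<Longrightarrow> K \<subseteq> unit_sphere"
  shows "has_sph_transversal k \<F> \<longleftrightarrow> cone_transversal (k + 1) (double_cone ` \<F>)"
proof
  assume "has_sph_transversal k \<F>"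
  then obtain V where "subspace V" "dim V = k + 1" "\<forall>K\<in>\<F>. unit_sphere \<inter> V \<inter> K \<noteq> {}"
    unfolding has_sph_transversal_def great_sphere_def by blast
  then show "cone_transversal (k + 1) (double_cone ` \<F>)"
    unfolding cone_transversal_def by (intro exI[of _ V]) (auto simp: subspace_meets_double_cone)
next
  assume "cone_transversal (k + 1) (double_cone ` \<F>)"
  then obtain V where V: "subspace V" "dim V \<le> k + 1" "\<forall>K\<in>double_cone ` \<F>. V \<inter> K \<noteq> {}"
    by (elim cone_transversalE)
  obtain U where U: "subspace U" "dim U = k + 1" "V \<subseteq> U" using subspace_extend_dim[OF V(1,2) k] by blast
  have "unit_sphere \<inter> U \<inter> K \<noteq> {}" if K: "K \<in> \<F>" for K
  proof -
    have "V \<inter> K \<noteq> {}" using V(3) K subspace_meets_double_cone[OF V(1)] by blast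
    then show ?thesis using U(3) sph[OF K] by blast
  qed
  then show "has_sph_transversal k \<F>"
    unfolding has_sph_transversal_def great_sphere_def using U(1,2) by blast
qed

section \<open>Specialising the cone version to the sphere, uniformly in \<open>k\<close>\<close>

theorem theorem2p2:
  fixes d :: nat and \<rho> :: real
  assumes "CARD('n::finite) = d + 1" and "\<rho> \<ge> 1"
  shows "\<exists>\<beta> :: real \<Rightarrow> real.
    (\<forall>\<alpha>\<in>{0<..1}. \<beta> \<alpha> \<in> {0<..<1}) \<and>
    (\<forall>(k::nat) (\<alpha>::real) (F :: nat \<Rightarrow> (real ^ 'n) set set).
       k \<le> d \<and> \<alpha> \<in> {0<..1} \<and>
       (\<forall>j\<in>{1..k+2}. finite (F j) \<and> F j \<noteq> {} \<and> fat_family \<rho> (F j) \<and>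
          (\<forall>K\<in>F j. sph_convex K)) \<and>
       real (card {K \<in> colorful_selections (k+2) F. has_sph_transversal k (K ` {1..k+2})})
         \<ge> \<alpha> * (\<Prod>j\<in>{1..k+2}. real (card (F j)))
       \<longrightarrow>
       (\<exists>i\<in>{1..k+2}. \<exists>G. G \<subseteq> F i \<and>
          real (card G) \<ge> \<beta> \<alpha> * real (card (F i)) \<and> has_sph_transversal k G))"
proof -
  \<comment> \<open>The members of the families serve as their own indices; \<open>D\<close> will be
    \<open>double_cone\<close>, and \<open>1 / (12 * \<rho>)\<close> is the constant of
    \<open>fat_cone_double_cone\<close>.\<close>
  define P where "P = (\<lambda>m (\<alpha>::real) (\<beta>::real). \<forall>W J (I :: nat \<Rightarrow> (real ^ 'n) set set)
      (D :: (real ^ 'n) set \<Rightarrow> (real ^ 'n) set) s.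
    subspace W \<longrightarrow> finite J \<longrightarrow> card J = Suc m \<longrightarrow>
    (\<forall>j\<in>J. finite (I j) \<and> I j \<noteq> {} \<and> (\<forall>b\<in>I j. fat_cone (1 / (12 * \<rho>)) W (s b) (D b))) \<longrightarrow>
    \<alpha> * (\<Prod>j\<in>J. real (card (I j))) \<le> real (card {f \<in> PiE J I. cone_transversal m (D ` f ` J)}) \<longrightarrow>
    (\<exists>j\<in>J. \<exists>G\<subseteq>I j. \<beta> * real (card (I j)) \<le> real (card G) \<and> cone_transversal m (D ` G)))"
  have ex: "\<exists>\<beta>. 0 < \<beta> \<and> P m \<alpha> \<beta>" if "0 < \<alpha>" for m \<alpha>
    unfolding P_def by (rule fractional_helly_cones) (use assms(2) that in \<open>auto simp: field_simps\<close>)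
  define b where "b = (\<lambda>m \<alpha>. SOME \<beta>. 0 < \<beta> \<and> P m \<alpha> \<beta>)"
  have b: "0 < b m \<alpha> \<and> P m \<alpha> (b m \<alpha>)" if "0 < \<alpha>" for m \<alpha>
    unfolding b_def by (rule someI_ex) (rule ex[OF that])
  \<comment> \<open>The function must not depend on \<open>k\<close>, hence the minimum over all
    \<open>k \<le> d\<close>; the entry \<open>1 / 2\<close> keeps the value below
    \<open>1\<close>.\<close>
  define \<beta> where "\<beta> = (\<lambda>\<alpha>. Min (insert (1 / 2) ((\<lambda>k. b (k + 1) \<alpha>) ` {..d})))"
  have \<beta>_range: "\<beta> \<alpha> \<in> {0<..<1}" if "0 < \<alpha>" for \<alpha>
  proof -
    have "\<beta> \<alpha> \<le> 1 / 2" unfolding \<beta>_def by (intro Min_le) auto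
    moreover have "0 < \<beta> \<alpha>" unfolding \<beta>_def using b[OF that] by (subst Min_gr_iff) auto
    ultimately show ?thesis by auto
  qed
  have \<beta>_le: "\<beta> \<alpha> \<le> b (k + 1) \<alpha>" if "k \<le> d" for k \<alpha>
    unfolding \<beta>_def using that by (intro Min_le) auto
  show ?thesis
  proof (intro exI[of _ \<beta>] conjI allI impI ballI)
    show "\<beta> \<alpha> \<in> {0<..<1}" if "\<alpha> \<in> {0<..1}" for \<alpha> using \<beta>_range that by simp
    fix k :: nat and \<alpha> :: real and F :: "nat \<Rightarrow> (real ^ 'n) set set"
    assume A: "k \<le> d \<and> \<alpha> \<in> {0<..1} \<and>
       (\<forall>j\<in>{1..k+2}. finite (F j) \<and> F j \<noteq> {} \<and> fat_family \<rho> (F j) \<and>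
          (\<forall>K\<in>F j. sph_convex K)) \<and>
       real (card {K \<in> colorful_selections (k+2) F. has_sph_transversal k (K ` {1..k+2})})
         \<ge> \<alpha> * (\<Prod>j\<in>{1..k+2}. real (card (F j)))"
    then have k: "k \<le> d" and \<alpha>: "0 < \<alpha>" by auto
    have F: "finite (F j)" "F j \<noteq> {}" "fat_family \<rho> (F j)" "\<And>K. K \<in> F j \<Longrightarrow> sph_convex K"
      if "j \<in> {1..k+2}" for j using A that by blast+
    have dense: "\<alpha> * (\<Prod>j\<in>{1..k+2}. real (card (F j)))
        \<le> real (card {K \<in> PiE {1..k+2} F. has_sph_transversal k (K ` {1..k+2})})"
      using A unfolding colorful_selections_def by blast
    have dim: "k + 1 \<le> DIM(real ^ 'n)" using k assms(1) by simp
    have tr: "has_sph_transversal k G \<longleftrightarrow> cone_transversal (k + 1) (double_cone ` G)"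
      if "\<And>K. K \<in> G \<Longrightarrow> \<exists>j\<in>{1..k+2}. K \<in> F j" for G
      using that F(4) by (intro has_sph_transversal_iff_cone_transversal[OF dim]) (meson sph_convex_def)
    have fat: "\<exists>s. fat_cone (1 / (12 * \<rho>)) UNIV s (double_cone K)" if j: "j \<in> {1..k+2}" and K: "K \<in> F j" for j K
    proof -
      obtain x r R where "x \<in> unit_sphere" "0 < r" "r \<le> R" "R \<le> \<rho> * r" "cap x r \<subseteq> K" "K \<subseteq> cap x R"
        using F(3)[OF j] K unfolding fat_family_def by blast
      then show ?thesis using fat_cone_double_cone[OF F(4)[OF j K] assms(2)] by blast
    qed
    define s where "s = (\<lambda>K :: (real ^ 'n) set. SOME s. fat_cone (1 / (12 * \<rho>)) UNIV s (double_cone K))"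
    have s: "fat_cone (1 / (12 * \<rho>)) UNIV (s K) (double_cone K)" if "j \<in> {1..k+2}" "K \<in> F j" for j K
      unfolding s_def by (rule someI_ex) (rule fat[OF that])
    have fam: "\<forall>j\<in>{1..k+2}. finite (F j) \<and> F j \<noteq> {} \<and>
        (\<forall>K\<in>F j. fat_cone (1 / (12 * \<rho>)) UNIV (s K) (double_cone K))"
      using F(1,2) s by blast
    have eq: "{K \<in> PiE {1..k+2} F. has_sph_transversal k (K ` {1..k+2})} =
        {f \<in> PiE {1..k+2} F. cone_transversal (k + 1) (double_cone ` f ` {1..k+2})}"
    proof (rule Collect_cong, rule conj_cong[OF refl], rule tr)
      fix f K assume "f \<in> PiE {1..k+2} F" "K \<in> f ` {1..k+2}"
      then show "\<exists>j\<in>{1..k+2}. K \<in> F j" by (auto dest: PiE_mem)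
    qed
    \<comment> \<open>The \<open>k + 2\<close> families are the right number for linear dimension
      \<open>k + 1\<close>.\<close>
    have cardJ: "card {1..k+2} = Suc (k + 1)" by simp
    have "P (k + 1) \<alpha> (b (k + 1) \<alpha>)" using b[OF \<alpha>] by blast
    from this[unfolded P_def, THEN spec, THEN spec, THEN spec, THEN spec, THEN spec, THEN mp, OF subspace_UNIV,
        THEN mp, OF finite_atLeastAtMost, THEN mp, OF cardJ, THEN mp, OF fam, THEN mp, OF dense[unfolded eq]]
    obtain i G where i: "i \<in> {1..k+2}" "G \<subseteq> F i" "b (k + 1) \<alpha> * real (card (F i)) \<le> real (card G)"
      "cone_transversal (k + 1) (double_cone ` G)" by auto
    have "\<beta> \<alpha> * real (card (F i)) \<le> real (card G)"
      using mult_right_mono[OF \<beta>_le[OF k], of "real (card (F i))" \<alpha>] i(3) by simp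
    moreover have "has_sph_transversal k G" using tr[of G] i by blast
    ultimately show "\<exists>i\<in>{1..k+2}. \<exists>G. G \<subseteq> F i \<and>
          real (card G) \<ge> \<beta> \<alpha> * real (card (F i)) \<and> has_sph_transversal k G" using i by blast
  qed
qed

end
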